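(* In the setting described in the context, the following holds for all sufficiently small $r>0$: there exists a number $\delta_1\in(0,1)$ such that for every $\lambda$ with $\delta_1\le\lambda<1$ the sets $$S_i(\lambda)=\{\lambda\xi_i(\rho)+(1-\lambda)\pi_i(\rho):\rho\in\mathbb B_r(0)\},\qquad i=1,\dots,N,$$ are open in $\mathbb R^{2\times n}\times\mathbb R^{2\times n}$ and pairwise disjoint.
   Context: Let $n\ge2$, $N=2n+1$, $d=n(n-1)/2$. **Parametrization.** For $p\in\mathbb R^2$, $a\in\mathbb R^n$ put $p\otimes a=pa^T$. For $\mathbf x,\mathbf y,\mathbf z\in\mathbb R^{n-1}$ and $1\le r\le n$ let $\alpha_r(\mathbf x)=(x_1,\dots,x_{r-1},1,x_r,\dots,x_{n-1})^T\in\mathbb R^n$; let $b_r(\mathbf x,\mathbf y)=(y_1,\dots,y_{r-1},-(\mathbf x\cdot\mathbf y),y_r,\dots,y_{n-1})$ (a row vector); and let $\beta_r(\mathbf x,\mathbf y,\mathbf z)\in\mathbb R^{2\times n}$ be the matrix with rows $b_r(\mathbf x,\mathbf y)$ and $b_r(\mathbf x,\mathbf z)$. For $1\le i\le N$ let $r_i\in\{1,\dots,n\}$ with $r_i\equiv i \pmod n$. The $n\times n$ matrix $b_r(\mathbf x,\mathbf y)\otimes\alpha_r(\mathbf x)$ has $(j,k)$ entry $b_r(\mathbf x,\mathbf y)_j\,\alpha_r(\mathbf x)_k$ (it has trace $0$). For $X=(\mathbf x_1,\dots,\mathbf x_N)\in(\mathbb R^{n-1})^N$ let $\Delta=\det[\alpha_1(\mathbf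 x_1)\cdots\alpha_n(\mathbf x_n)]$, and let $T$ be the determinant of the linear map $\mathbb R^{n^2-1}\to\mathbb R^{n^2-1}$ sending $(\mathbf y_1,\dots,\mathbf y_{n+1})$ to the entries other than the $(1,1)$ entry of $\sum_{i=1}^{n+1}b_{r_i}(\mathbf x_i,\mathbf y_i)\otimes\alpha_{r_i}(\mathbf x_i)$. $\mathcal V$ is the set of $(P,X)$, $P=(p_{n+1},\dots,p_N)\in(\mathbb R^2)^{N-n}$, such that $\Delta\neq0$, $T\ne0$, $p_j\neq0$ for $n+1\le j\le N$, and the vectors $p_1,\dots,p_n\in\mathbb R^2$ uniquely determined by $\sum_{i=1}^Np_i\otimes\alpha_{r_i}(\mathbf x_i)=0$ are all nonzero. $\mathcal U$ is the set (open in $\mathbb R^{2nN}$) of $U=(P,X,Y,Z,b,\kappa_1,\dots,\kappa_N)$ with $(P,X)\in\mathcal V$, $Y=(\mathbf y_{n+2},\dots,\mathbf y_N)$, $Z=(\mathbf z_{n+2},\dots,\mathbf z_N)$, $\mathbf y_j,\mathbf z_j\in\mathbb R^{n-1}$, $b\in\mathbb R^{n-2}$, $\kappa_i>1$. For $U\in\mathcal U$: $p_1,\dots,p_n\in\mathbb R^2$ are the unique vectors satisfying $\sum_{i=1}^Np_i\otimes\alpha_{r_i}(\mathbf x_i)=0$, where $p_{n+1},\dots,p_N$ are the components of $P$; $\mathbf y_1,\dots,\mathbf y_{n+1}$ (resp. $\mathbf z_1,\dots,\mathbf z_{n+1}$) are the unique solutions of $\sum_{i=1}^Nb_{r_i}(\mathbf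 x_i,\mathbf y_i)\otimes\alpha_{r_i}(\mathbf x_i)=0$ (resp. with $\mathbf z_i$ in place of $\mathbf y_i$); $q(b)=(1,1,b_1,\dots,b_{n-2})^T$; and $a_i(U)=\alpha_{r_i}(\mathbf x_i)$, $B_i(U)=\beta_{r_i}(\mathbf x_i,\mathbf y_i,\mathbf z_i)$, $s_i(U)=a_i(U)\cdot q(b)$, $\gamma_i(U)=(p_i\otimes a_i(U),s_i(U)B_i(U))\in\mathbb R^{2\times n}\times\mathbb R^{2\times n}$, $\eta_i(U)=(\eta_i^1(U),\eta_i^2(U))=\gamma_1(U)+\cdots+\gamma_{i-1}(U)+\kappa_i\gamma_i(U)$; $\kappa_i(U)=\kappa_i$. **The function $F$.** $J(A)\in\mathbb R^d$ is the tuple of all $2\times2$ subdeterminants of $A\in\mathbb R^{2\times n}$; $v\,DJ(A)$ is the gradient of $A\mapsto v\cdot J(A)$. Let $U_0\in\mathcal U$, $c_i\in\mathbb R$, $d_i\in\mathbb R^d$ satisfy $c_j-c_i>\langle\eta_i^2(U_0),\eta_j^1(U_0)-\eta_i^1(U_0)\rangle+d_i\cdot J(\eta_j^1(U_0)-\eta_i^1(U_0))$ for all $i\neq j$. Let $F_0(A)=\frac\epsilon2|A|^2+G(A,J(A))$ with $\epsilon>0$ and $G\colon\mathbb R^{2\times n}\times\mathbb R^d\to\mathbb R$ smooth and convex such that at $(\eta_i^1(U_0),J(\eta_i^1(U_0)))$ one has $G=c_i$, $G_J=d_i$, $G_A=\eta_i^2(U_0)-\epsilon\eta_i^1(U_0)-d_iDJ(\eta_i^1(U_0))$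 for all $i$. Fix $\zeta\in C_c^\infty(B_1(0);[0,1])$ ($B_1(0)\subset\mathbb R^{2\times n}$ the unit ball) equal to $1$ at $0$ and such that the functions $V_{H,t}(A)=\frac12\zeta(A/t)\sum H^{ijpq}a_{ij}a_{pq}$ ($t>0$, $H$ a real tensor with $H^{ijpq}=H^{pqij}$, $1\le i,p\le2$, $1\le j,q\le n$) satisfy $V_{H,t}(0)=0$, $DV_{H,t}(0)=0$, $D^2V_{H,t}(0)=H$, $|D^2V_{H,t}|\le C_0|H|$ with $C_0$ independent of $H,t$. Let $r_0=\min_{i\ne j}|\eta_i^1(U_0)-\eta_j^1(U_0)|>0$. Given such tensors $H_1^0,\dots,H_N^0$, put $\tilde H_j=H_j^0-D^2F_0(\eta_j^1(U_0))$ and $F(A)=F_0(A)+\sum_{j=1}^NV_{\tilde H_j,r_0}(A-\eta_j^1(U_0))$. Put $\Phi(A,B)=DF(A)-B$ and $\Psi(\rho,U)=(\Phi(\rho+\eta_1(U)),\dots,\Phi(\rho+\eta_N(U)))\in\mathbb R^{2nN}$ for $\rho\in\mathbb R^{2\times n}\times\mathbb R^{2\times n}$, $U\in\mathcal U$ (so $\Psi(0,U_0)=0$). Assume $\det\frac{\partial\Psi}{\partial U}(0,U_0)\ne0$ and $\sum_j|\tilde H_j|<\epsilon/(2C_0)$. **Functions of $\rho$.** $\mathbb B_r(0)$ is the open ball of radius $r$ in $\mathbb R^{2\times n}\times\mathbb R^{2\times n}\cong\mathbb R^{4n}$ and $\bar{\mathbb B}_r(0)$ its closure. For small $r$ let $U\colon\bar{\mathbb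 B}_r(0)\to\mathcal U$ be the smooth function given by the implicit function theorem, with $U(0)=U_0$, $\Psi(\rho,U(\rho))=0$. Put $\xi_i(\rho)=\rho+\eta_i(U(\rho))$, $\pi_1(\rho)=\rho$, $\pi_{i+1}(\rho)=\pi_i(\rho)+\gamma_i(U(\rho))$, $z_i(\rho)=\kappa_i(U(\rho))\gamma_i(U(\rho))$ (so $\xi_i=\pi_i+z_i$). Assume: $\det D\pi_i\neq0$ on $\bar{\mathbb B}_r(0)$, each $\pi_i(\mathbb B_r(0))$ is open, and for $i\ne j$ the sets $\xi_i^1(\bar{\mathbb B}_r(0))$, $\xi_j^1(\bar{\mathbb B}_r(0))$ are disjoint and $\pi_i^1(\bar{\mathbb B}_r(0))$, $\pi_j^1(\bar{\mathbb B}_r(0))$ are disjoint (superscript $1$ = first $\mathbb R^{2\times n}$-component). Put $M_i(\rho)=(D\pi_i(\rho))^{-1}Dz_i(\rho)$ ($4n\times 4n$). Its characteristic polynomial has the form $\det[xI-M_i(\rho)]=x^{n+1}(x+1)^{2n}Q(\rho)(x)$ with $Q(\rho)$ monic of degree $n-1$ ($Q$ depends on $i$). Let $E_i(\rho)=\{x<-1:Q(\rho)(x)=0\}$. **Nondegeneracy at $0$.** Assume for every $i$: the discriminant of $Q(0)$ is nonzero, $Q(0)(-1)\neq0$, and $[\operatorname{adj}(x^0I-M_i(0))][\operatorname{adj}D\pi_i(0)]\,z_i(0)\ne0$ for every $x^0\in E_i(0)$ (adj = adjugate). *)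

theory Defs
  imports
    "HOL-Analysis.Analysis"
    "HOL-Number_Theory.Cong"
    "Jordan_Normal_Form.Char_Poly"
    "Subresultants.Resultant_Prelim"
begin

no_notation Matrix.vec_index (infixl "$" 100)
no_notation Matrix.scalar_prod (infix "\<bullet>" 70)

text \<open>
  The dimension \<open>n\<close> is \<open>CARD('n)\<close> for a linearly ordered finite index type \<open>'n\<close>; the
  \<open>k\<close>-th element of \<open>'n\<close> (counting from 1) plays the role of the index \<open>k\<close>. The data that live
  in spaces such as \<open>\<real>\<^sup>n\<^sup>-\<^sup>1\<close> or \<open>\<real>\<^sup>n\<^sup>-\<^sup>2\<close> (which may be trivial) are functions on \<open>nat\<close> that
  are only evaluated at indices starting from 1 and running up to the respective dimension.
\<close>

type_synonym 'n mat2 = "real^'n^2"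
type_synonym 'n phase = "(real^'n^2) \<times> (real^'n^2)"
type_synonym 'n tensor4 = "real^'n^2^'n^2"

definition pos :: "'n::{finite,linorder} \<Rightarrow> nat" where
  "pos k = card {..k}"

text \<open>
  For open \<open>S\<close> in a finite-dimensional space, \<open>smooth_on S\<close> is \<open>C\<^sup>\<infinity>\<close>: directional
  derivatives of all orders exist as Frechet derivatives and are continuous.
\<close>

primrec times_differentiable_on ::
    "nat \<Rightarrow> 'a::real_normed_vector set \<Rightarrow> ('a \<Rightarrow> 'b::real_normed_vector) \<Rightarrow> bool" where
  "times_differentiable_on 0 S f \<longleftrightarrow> continuous_on S f"
| "times_differentiable_on (Suc k) S f \<longleftrightarrow>
     (\<forall>x\<in>S. f differentiable (at x)) \<and>
     (\<forall>v. times_differentiable_on k S (\<lambda>x. frechet_derivative f (at x) v))"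

definition smooth_on :: "'a::real_normed_vector set \<Rightarrow> ('a \<Rightarrow> 'b::real_normed_vector) \<Rightarrow> bool" where
  "smooth_on S f \<longleftrightarrow> (\<forall>k. times_differentiable_on k S f)"

definition gradient :: "('a::real_inner \<Rightarrow> real) \<Rightarrow> 'a \<Rightarrow> 'a" where
  "gradient f x = (THE D. GDERIV f x :> D)"

definition hessian :: "('n::finite mat2 \<Rightarrow> real) \<Rightarrow> 'n mat2 \<Rightarrow> 'n tensor4" where
  "hessian f A = (\<chi> i j. gradient (\<lambda>A'. gradient f A' $ i $ j) A)"

definition phase_basis :: "'n::{finite,linorder} phase list" where
  "phase_basis =
     [(axis a (axis k 1), 0). a \<leftarrow> [1, 2], k \<leftarrow> sorted_list_of_set UNIV] @
     [(0, axis a (axis k 1)). a \<leftarrow> [1, 2], k \<leftarrow> sorted_list_of_set UNIV]"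

definition phase_vec :: "'n::{finite,linorder} phase \<Rightarrow> real Matrix.vec" where
  "phase_vec v = Matrix.vec (4 * CARD('n)) (\<lambda>i. v \<bullet> phase_basis ! i)"

definition phase_mat :: "('n::{finite,linorder} phase \<Rightarrow> 'n phase) \<Rightarrow> real Matrix.mat" where
  "phase_mat L = Matrix.mat (4 * CARD('n)) (4 * CARD('n))
     (\<lambda>(i, j). L (phase_basis ! j) \<bullet> phase_basis ! i)"

definition jacobian :: "('n::{finite,linorder} phase \<Rightarrow> 'n phase) \<Rightarrow> 'n phase \<Rightarrow> real Matrix.mat" where
  "jacobian f \<rho> = phase_mat (frechet_derivative f (at \<rho>))"

text \<open>The usual discriminant \<open>(-1)\<^sup>m\<^sup>(\<^sup>m\<^sup>-\<^sup>1\<^sup>)\<^sup>/\<^sup>2 Res(q, q') / lc(q)\<close>, \<open>m = deg q\<close>.\<close>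

definition discriminant :: "real poly \<Rightarrow> real" where
  "discriminant q =
     (-1) ^ (degree q * (degree q - 1) div 2) * resultant q (pderiv q) / lead_coeff q"

definition alpha :: "nat \<Rightarrow> (nat \<Rightarrow> real) \<Rightarrow> nat \<Rightarrow> real" where
  "alpha r x k = (if k < r then x k else if k = r then 1 else x (k - 1))"

definition brow :: "nat \<Rightarrow> nat \<Rightarrow> (nat \<Rightarrow> real) \<Rightarrow> (nat \<Rightarrow> real) \<Rightarrow> nat \<Rightarrow> real" where
  "brow n r x y j =
     (if j < r then y j else if j = r then - (\<Sum>l=1..n-1. x l * y l) else y (j - 1))"

definition beta ::
    "nat \<Rightarrow> nat \<Rightarrow> (nat \<Rightarrow> real) \<Rightarrow> (nat \<Rightarrow> real) \<Rightarrow> (nat \<Rightarrow> real) \<Rightarrow> 2 \<Rightarrow> nat \<Rightarrow> real" where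
  "beta n r x y z a j = (if a = 1 then brow n r x y j else brow n r x z j)"

text \<open>The representative \<open>r\<^sub>i\<close> of \<open>i\<close> modulo \<open>n\<close> in \<open>{1,\<dots>,n}\<close>.\<close>

definition res :: "nat \<Rightarrow> nat \<Rightarrow> nat" where
  "res n i = (THE r. r \<in> {1..n} \<and> [r = i] (mod n))"

definition Delta :: "nat \<Rightarrow> (nat \<Rightarrow> nat \<Rightarrow> real) \<Rightarrow> real" where
  "Delta n X = Determinant.det (Matrix.mat n n (\<lambda>(k, i). alpha (Suc i) (X (Suc i)) (Suc k)))"

text \<open>
  \<open>T\<close> is the determinant of the matrix of \<open>T_map\<close> with respect to the unit vectors
  of \<open>(\<real>\<^sup>n\<^sup>-\<^sup>1)\<^sup>n\<^sup>+\<^sup>1\<close>, numbered by \<open>T_dom\<close>, and the matrix entries other than \<open>(1,1)\<close>,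
  numbered row by row by \<open>T_cod\<close>.
\<close>

definition T_map ::
    "nat \<Rightarrow> (nat \<Rightarrow> nat \<Rightarrow> real) \<Rightarrow> (nat \<Rightarrow> nat \<Rightarrow> real) \<Rightarrow> nat \<times> nat \<Rightarrow> real" where
  "T_map n X Y = (\<lambda>(j, k).
     \<Sum>i=1..n+1. brow n (res n i) (X i) (Y i) j * alpha (res n i) (X i) k)"

definition T_dom :: "nat \<Rightarrow> (nat \<times> nat) list" where
  "T_dom n = [(i, l). i \<leftarrow> [1..<n+2], l \<leftarrow> [1..<n]]"

definition T_cod :: "nat \<Rightarrow> (nat \<times> nat) list" where
  "T_cod n = [(j, k). j \<leftarrow> [1..<n+1], k \<leftarrow> [1..<n+1], (j, k) \<noteq> (1, 1)]"

definition T :: "nat \<Rightarrow> (nat \<Rightarrow> nat \<Rightarrow> real) \<Rightarrow> real" where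
  "T n X = Determinant.det (Matrix.mat (n^2 - 1) (n^2 - 1) (\<lambda>(u, v).
     T_map n X (\<lambda>i l. if (i, l) = T_dom n ! v then 1 else 0) (T_cod n ! u)))"

text \<open>
  Given \<open>p\<^sub>n\<^sub>+\<^sub>1,\<dots>,p\<^sub>N\<close> in \<open>P\<close>, the family \<open>p\<^sub>1,\<dots>,p\<^sub>N\<close> with \<open>\<Sum> p\<^sub>i \<otimes> \<alpha>\<close>\<open>(x\<^sub>i) = 0\<close>,
  set to 0 outside \<open>{1,\<dots>,N}\<close> to make it unique.
\<close>

definition p_family ::
    "nat \<Rightarrow> (nat \<Rightarrow> real^2) \<Rightarrow> (nat \<Rightarrow> nat \<Rightarrow> real) \<Rightarrow> nat \<Rightarrow> real^2" where
  "p_family n P X = (THE p.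
     (\<forall>i. i \<notin> {1..2*n+1} \<longrightarrow> p i = 0) \<and>
     (\<forall>i\<in>{n+1..2*n+1}. p i = P i) \<and>
     (\<forall>a. \<forall>k\<in>{1..n}. (\<Sum>i=1..2*n+1. p i $ a * alpha (res n i) (X i) k) = 0))"

definition V_set :: "nat \<Rightarrow> ((nat \<Rightarrow> real^2) \<times> (nat \<Rightarrow> nat \<Rightarrow> real)) set" where
  "V_set n = {(P, X). Delta n X \<noteq> 0 \<and> T n X \<noteq> 0 \<and>
     (\<forall>j\<in>{n+1..2*n+1}. P j \<noteq> 0) \<and> (\<forall>i\<in>{1..n}. p_family n P X i \<noteq> 0)}"

text \<open>The family \<open>y\<^sub>1,\<dots>,y\<^sub>N\<close> determined by \<open>y\<^sub>n\<^sub>+\<^sub>2,\<dots>,y\<^sub>N\<close>.\<close>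

definition y_family ::
    "nat \<Rightarrow> (nat \<Rightarrow> nat \<Rightarrow> real) \<Rightarrow> (nat \<Rightarrow> nat \<Rightarrow> real) \<Rightarrow> nat \<Rightarrow> nat \<Rightarrow> real" where
  "y_family n X Y = (THE y.
     (\<forall>i l. \<not> (i \<in> {1..2*n+1} \<and> l \<in> {1..n-1}) \<longrightarrow> y i l = 0) \<and>
     (\<forall>i\<in>{n+2..2*n+1}. \<forall>l\<in>{1..n-1}. y i l = Y i l) \<and>
     (\<forall>j\<in>{1..n}. \<forall>k\<in>{1..n}.
        (\<Sum>i=1..2*n+1. brow n (res n i) (X i) (y i) j * alpha (res n i) (X i) k) = 0))"

text \<open>
  A tuple \<open>U = (P,X,Y,Z,b,\<kappa>\<^sub>1,\<dots>,\<kappa>\<^sub>N)\<close> is the function assigning a value to each of its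
  \<open>2nN\<close> scalar coordinates, which are listed in \<open>coords\<close>; it vanishes elsewhere.
\<close>

datatype coord =
  CP nat "2" | CX nat nat | CY nat nat | CZ nat nat | Cb nat | Ckappa nat

type_synonym param = "coord \<Rightarrow> real"

definition coords :: "nat \<Rightarrow> coord list" where
  "coords n =
     [CP j a. j \<leftarrow> [n+1..<2*n+2], a \<leftarrow> [1, 2]] @
     [CX i l. i \<leftarrow> [1..<2*n+2], l \<leftarrow> [1..<n]] @
     [CY j l. j \<leftarrow> [n+2..<2*n+2], l \<leftarrow> [1..<n]] @
     [CZ j l. j \<leftarrow> [n+2..<2*n+2], l \<leftarrow> [1..<n]] @
     [Cb l. l \<leftarrow> [1..<n-1]] @
     [Ckappa i. i \<leftarrow> [1..<2*n+2]]"

definition P_of :: "param \<Rightarrow> nat \<Rightarrow> real^2" where "P_of U j = (\<chi> a. U (CP j a))"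
definition X_of :: "param \<Rightarrow> nat \<Rightarrow> nat \<Rightarrow> real" where "X_of U i l = U (CX i l)"
definition Y_of :: "param \<Rightarrow> nat \<Rightarrow> nat \<Rightarrow> real" where "Y_of U j l = U (CY j l)"
definition Z_of :: "param \<Rightarrow> nat \<Rightarrow> nat \<Rightarrow> real" where "Z_of U j l = U (CZ j l)"
definition b_of :: "param \<Rightarrow> nat \<Rightarrow> real" where "b_of U l = U (Cb l)"
definition kappa :: "param \<Rightarrow> nat \<Rightarrow> real" where "kappa U i = U (Ckappa i)"

definition U_set :: "nat \<Rightarrow> param set" where
  "U_set n = {U. (\<forall>c. c \<notin> set (coords n) \<longrightarrow> U c = 0) \<and>
     (P_of U, X_of U) \<in> V_set n \<and> (\<forall>i\<in>{1..2*n+1}. kappa U i > 1)}"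

definition p_vec :: "nat \<Rightarrow> param \<Rightarrow> nat \<Rightarrow> real^2" where
  "p_vec n U = p_family n (P_of U) (X_of U)"

definition a_vec :: "nat \<Rightarrow> param \<Rightarrow> nat \<Rightarrow> nat \<Rightarrow> real" where
  "a_vec n U i = alpha (res n i) (X_of U i)"

definition B_mat :: "nat \<Rightarrow> param \<Rightarrow> nat \<Rightarrow> 2 \<Rightarrow> nat \<Rightarrow> real" where
  "B_mat n U i = beta n (res n i) (X_of U i)
     (y_family n (X_of U) (Y_of U) i) (y_family n (X_of U) (Z_of U) i)"

definition q_vec :: "(nat \<Rightarrow> real) \<Rightarrow> nat \<Rightarrow> real" where
  "q_vec b k = (if k \<le> 2 then 1 else b (k - 2))"

definition s_val :: "nat \<Rightarrow> param \<Rightarrow> nat \<Rightarrow> real" where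
  "s_val n U i = (\<Sum>k=1..n. a_vec n U i k * q_vec (b_of U) k)"

definition gamma :: "param \<Rightarrow> nat \<Rightarrow> 'n::{finite,linorder} phase" where
  "gamma U i =
     ((\<chi> a k. p_vec CARD('n) U i $ a * a_vec CARD('n) U i (pos k)),
      (\<chi> a k. s_val CARD('n) U i * B_mat CARD('n) U i a (pos k)))"

definition eta :: "param \<Rightarrow> nat \<Rightarrow> 'n::{finite,linorder} phase" where
  "eta U i = (\<Sum>j\<in>{1..<i}. gamma U j) + kappa U i *\<^sub>R gamma U i"

text \<open>
  \<open>mn\<close> enumerates the pairs of columns \<open>j < k\<close> by a type \<open>'d\<close> with \<open>n(n-1)/2\<close> elements.
\<close>

definition minors :: "('d \<Rightarrow> 'n \<times> 'n) \<Rightarrow> 'n::finite mat2 \<Rightarrow> real^'d::finite" where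
  "minors mn A = (\<chi> m. A $ 1 $ fst (mn m) * A $ 2 $ snd (mn m)
                       - A $ 1 $ snd (mn m) * A $ 2 $ fst (mn m))"

definition v_DJ :: "('d \<Rightarrow> 'n \<times> 'n) \<Rightarrow> real^'d::finite \<Rightarrow> 'n::finite mat2 \<Rightarrow> 'n mat2" where
  "v_DJ mn v A = gradient (\<lambda>A'. v \<bullet> minors mn A') A"

definition sym_tensor :: "'n::finite tensor4 \<Rightarrow> bool" where
  "sym_tensor H \<longleftrightarrow> (\<forall>i j p q. H $ i $ j $ p $ q = H $ p $ q $ i $ j)"

definition V_fun ::
    "('n::finite mat2 \<Rightarrow> real) \<Rightarrow> 'n tensor4 \<Rightarrow> real \<Rightarrow> 'n mat2 \<Rightarrow> real" where
  "V_fun \<zeta> H t A = 1/2 * \<zeta> (A /\<^sub>R t) *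
     (\<Sum>i\<in>UNIV. \<Sum>j\<in>UNIV. \<Sum>p\<in>UNIV. \<Sum>q\<in>UNIV. H $ i $ j $ p $ q * A $ i $ j * A $ p $ q)"

definition Phi :: "('n::finite mat2 \<Rightarrow> real) \<Rightarrow> 'n phase \<Rightarrow> 'n mat2" where
  "Phi F = (\<lambda>(A, B). gradient F A - B)"

text \<open>The \<open>i\<close>-th component of \<open>\<Psi>\<close>.\<close>

definition Psi ::
    "('n::{finite,linorder} mat2 \<Rightarrow> real) \<Rightarrow> 'n phase \<Rightarrow> param \<Rightarrow> nat \<Rightarrow> 'n mat2" where
  "Psi F \<rho> U i = Phi F (\<rho> + eta U i)"

definition Psi_rows :: "(nat \<times> 2 \<times> 'n::{finite,linorder}) list" where
  "Psi_rows = [(i, a, k).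
     i \<leftarrow> [1..<2*CARD('n)+2], a \<leftarrow> [1, 2], k \<leftarrow> sorted_list_of_set UNIV]"

definition dPsi_dU ::
    "('n::{finite,linorder} mat2 \<Rightarrow> real) \<Rightarrow> 'n phase \<Rightarrow> param \<Rightarrow> real Matrix.mat" where
  "dPsi_dU F \<rho> U =
     Matrix.mat (2 * CARD('n) * (2*CARD('n)+1)) (2 * CARD('n) * (2*CARD('n)+1))
       (\<lambda>(u, v). case Psi_rows ! u of (i, a, k) \<Rightarrow>
          let c = coords CARD('n) ! v in
          deriv (\<lambda>t. Psi F \<rho> (U(c := t)) i $ a $ k) (U c))"

definition xi_fun ::
    "('n::{finite,linorder} phase \<Rightarrow> param) \<Rightarrow> nat \<Rightarrow> 'n phase \<Rightarrow> 'n phase" where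
  "xi_fun U i \<rho> = \<rho> + eta (U \<rho>) i"

definition pi_fun ::
    "('n::{finite,linorder} phase \<Rightarrow> param) \<Rightarrow> nat \<Rightarrow> 'n phase \<Rightarrow> 'n phase" where
  "pi_fun U i \<rho> = \<rho> + (\<Sum>j\<in>{1..<i}. gamma (U \<rho>) j)"

definition z_fun ::
    "('n::{finite,linorder} phase \<Rightarrow> param) \<Rightarrow> nat \<Rightarrow> 'n phase \<Rightarrow> 'n phase" where
  "z_fun U i \<rho> = kappa (U \<rho>) i *\<^sub>R gamma (U \<rho>) i"

definition M_mat ::
    "('n::{finite,linorder} phase \<Rightarrow> param) \<Rightarrow> nat \<Rightarrow> 'n phase \<Rightarrow> real Matrix.mat" where
  "M_mat U i \<rho> = phase_mat
     (inv_into UNIV (frechet_derivative (pi_fun U i) (at \<rho>)) 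
        \<circ> frechet_derivative (z_fun U i) (at \<rho>))"

definition E_set :: "real poly \<Rightarrow> real set" where
  "E_set q = {x. x < -1 \<and> poly q x = 0}"

definition S_set ::
    "('n::{finite,linorder} phase \<Rightarrow> param) \<Rightarrow> real \<Rightarrow> real \<Rightarrow> nat \<Rightarrow> 'n phase set" where
  "S_set U r l i = (\<lambda>\<rho>. l *\<^sub>R xi_fun U i \<rho> + (1 - l) *\<^sub>R pi_fun U i \<rho>) ` ball 0 r"

lemma pos_bij: "bij_betw (pos :: 'n::{finite,linorder} \<Rightarrow> nat) UNIV {1..CARD('n)}"
proof -
  have less: "pos x < pos y" if "x < y" for x y :: 'n
    unfolding pos_def using that by (intro psubset_card_mono) auto
  have inj: "inj (pos :: 'n \<Rightarrow> nat)"
    by (rule injI) (metis less less_irrefl neqE)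
  have sub: "range (pos :: 'n \<Rightarrow> nat) \<subseteq> {1..CARD('n)}"
  proof
    fix m assume "m \<in> range (pos :: 'n \<Rightarrow> nat)"
    then obtain x :: 'n where "m = card {..x}" by (auto simp: pos_def)
    moreover have "card {..x} > 0" by (auto simp: card_gt_0_iff)
    moreover have "card {..x} \<le> CARD('n)" by (intro card_mono) auto
    ultimately show "m \<in> {1..CARD('n)}" by (simp add: Suc_le_eq)
  qed
  have "range (pos :: 'n \<Rightarrow> nat) = {1..CARD('n)}"
    by (rule card_subset_eq[OF _ sub]) (auto simp: card_image[OF inj])
  with inj show ?thesis by (simp add: bij_betw_def)
qed

lemma res_eq:
  assumes "i \<ge> 1" "n \<ge> 1"
  shows "res n i = (i - 1) mod n + 1"
  unfolding res_def
proof (rule the_equality)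
  show "(i - 1) mod n + 1 \<in> {1..n} \<and> [(i - 1) mod n + 1 = i] (mod n)"
    using assms by (auto simp: cong_def Suc_le_eq mod_Suc_eq)
next
  fix r assume r: "r \<in> {1..n} \<and> [r = i] (mod n)"
  then have "[r - 1 + 1 = i - 1 + 1] (mod n)" using assms by simp
  then have "[r - 1 = i - 1] (mod n)" by (simp only: cong_add_rcancel_nat)
  moreover have "r - 1 < n" using r by auto
  ultimately have "r - 1 = (i - 1) mod n" by (simp add: cong_def)
  then show "r = (i - 1) mod n + 1" using r by auto
qed

lemma length_coords:
  assumes "n \<ge> 2"
  shows "length (coords n) = 2 * n * (2 * n + 1)"
proof -
  obtain m where n: "n = m + 2" using assms by (metis add.commute le_Suc_ex)
  have const: "sum_list (map (\<lambda>x. k) xs) = length xs * k" for k :: nat and xs :: "nat list"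
    by (induction xs) auto
  have d: "2*n+2 - (n+1) = m+3" "2*n+2 - 1 = 2*m+5" "n - 1 = m+1" "2*n+2 - (n+2) = m+2"
    "n - 1 - 1 = m"
    using n by auto
  have "length (coords n) =
      (2*n+2 - (n+1)) * 2 + (2*n+2 - 1) * (n - 1) + (2*n+2 - (n+2)) * (n - 1)
      + (2*n+2 - (n+2)) * (n - 1) + (n - 1 - 1) + (2*n+2 - 1)"
    unfolding coords_def length_append length_concat map_map o_def length_map length_upt
    by (simp only: length_map length_upt const) (simp add: const)
  also have "\<dots> = 2 * n * (2 * n + 1)"
    unfolding d by (simp add: n algebra_simps)
  finally show ?thesis .
qed

lemma length_phase_basis: "length (phase_basis :: 'n::{finite,linorder} phase list) = 4 * CARD('n)"
  by (simp add: phase_basis_def)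

lemma pi_fun_1: "pi_fun U 1 \<rho> = \<rho>"
  by (simp add: pi_fun_def)

lemma pi_fun_Suc: "i \<ge> 1 \<Longrightarrow> pi_fun U (i + 1) \<rho> = pi_fun U i \<rho> + gamma (U \<rho>) i"
  by (simp add: pi_fun_def add.assoc)

lemma xi_fun_eq: "xi_fun U i \<rho> = pi_fun U i \<rho> + z_fun U i \<rho>"
  by (simp add: xi_fun_def pi_fun_def z_fun_def eta_def add.assoc)

end

theory Submission
  imports Defs
begin

text \<open>
  Since \<open>\<xi>\<^sub>i = \<pi>\<^sub>i + z\<^sub>i\<close>, the set \<open>S\<^sub>i(\<lambda>)\<close> is the image of the ball under \<open>\<pi>\<^sub>i + \<lambda> z\<^sub>i\<close>, whose derivative
  \<open>D\<pi>\<^sub>i (I + \<lambda> M\<^sub>i)\<close> is singular only if \<open>-1/\<lambda>\<close> is a root of the characteristic polynomial of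
  \<open>M\<^sub>i\<close>. For \<open>0 < \<lambda> < 1\<close> this means \<open>Q(\<rho>)(-1/\<lambda>) = 0\<close>, which is excluded near \<open>\<rho> = 0\<close>, \<open>\<lambda> = 1\<close> by
  \<open>Q(0)(-1) \<noteq> 0\<close> and continuity. So \<open>\<pi>\<^sub>i + \<lambda> z\<^sub>i\<close> has invertible derivative and is an open map. Disjointness
  holds because the first components of the \<open>\<xi>\<^sub>i\<close> have disjoint compact images, hence a positive
  distance, while \<open>(1 - \<lambda>) z\<^sub>i\<close> tends to 0 uniformly. The functions \<open>\<pi>\<^sub>i\<close> and \<open>z\<^sub>i\<close> are \<open>C\<^sup>1\<close> since the
  \<open>p\<^sub>i\<close> and the vectors entering \<open>B\<^sub>i\<close> are given by Cramer's rule with the nonvanishing determinants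
  \<open>\<Delta>\<close> and \<open>T\<close>.
\<close>

section \<open>Continuously differentiable functions\<close>

text \<open>The derivative is an existential witness, so explicit formulas can be supplied.
  Continuity is asked for each fixed direction \<open>v\<close>; for a finite-dimensional domain
  this is the same as continuity in operator norm.\<close>

definition C1_on :: "'a::real_normed_vector set \<Rightarrow> ('a \<Rightarrow> 'b::real_normed_vector) \<Rightarrow> bool" where
  "C1_on S f \<longleftrightarrow> (\<exists>f'. (\<forall>x\<in>S. (f has_derivative f' x) (at x)) \<and> (\<forall>v. continuous_on S (\<lambda>x. f' x v)))"

lemma C1_onI:
  assumes "\<And>x. x \<in> S \<Longrightarrow> (f has_derivative f' x) (at x)" "\<And>v. continuous_on S (\<lambda>x. f' x v)"
  shows "C1_on S f"
  using assms unfolding C1_on_def by blast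

lemma C1_onE:
  assumes "C1_on S f"
  obtains f' where "\<And>x. x \<in> S \<Longrightarrow> (f has_derivative f' x) (at x)"
    "\<And>v. continuous_on S (\<lambda>x. f' x v)"
  using assms unfolding C1_on_def by blast

text \<open>Uniqueness of the derivative identifies the witness with
  \<open>frechet_derivative\<close>, the form in which \<open>jacobian\<close> and
  \<open>M_mat\<close> are written.\<close>

lemma C1_on_frechet_derivative:
  assumes "C1_on S f"
  shows "x \<in> S \<Longrightarrow> (f has_derivative frechet_derivative f (at x)) (at x)"
    and "continuous_on S (\<lambda>x. frechet_derivative f (at x) v)"
proof -
  obtain f' where f': "\<And>x. x \<in> S \<Longrightarrow> (f has_derivative f' x) (at x)"
    "\<And>v. continuous_on S (\<lambda>x. f' x v)"
    using assms by (elim C1_onE) blast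
  have eq: "frechet_derivative f (at x) = f' x" if "x \<in> S" for x
    using frechet_derivative_at[OF f'(1)[OF that]] by simp
  show "x \<in> S \<Longrightarrow> (f has_derivative frechet_derivative f (at x)) (at x)"
    using f'(1) eq by simp
  show "continuous_on S (\<lambda>x. frechet_derivative f (at x) v)"
    using f'(2)[of v] eq by (simp cong: continuous_on_cong)
qed

lemma C1_on_continuous_on: "C1_on S f \<Longrightarrow> continuous_on S f"
  unfolding C1_on_def by (blast intro: continuous_at_imp_continuous_on has_derivative_continuous)

lemma C1_on_cong:
  assumes "open S" "\<And>x. x \<in> S \<Longrightarrow> f x = g x" "C1_on S g"
  shows "C1_on S f"
proof -
  obtain g' where g': "\<And>x. x \<in> S \<Longrightarrow> (g has_derivative g' x) (at x)"
    "\<And>v. continuous_on S (\<lambda>x. g' x v)"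
    using assms(3) by (elim C1_onE) blast
  show ?thesis
  proof (rule C1_onI[OF _ g'(2)])
    fix x assume "x \<in> S"
    then show "(f has_derivative g' x) (at x)"
      using has_derivative_transform_within_open[OF g'(1) assms(1)] assms(2) by simp
  qed
qed

lemma C1_on_subset: "C1_on S f \<Longrightarrow> S' \<subseteq> S \<Longrightarrow> C1_on S' f"
  unfolding C1_on_def by (blast intro: continuous_on_subset)

text \<open>One unfolding of the recursion in \<open>times_differentiable_on\<close> gives exactly
  differentiability and continuous directional derivatives.\<close>

lemma smooth_on_imp_C1_on:
  assumes "smooth_on S f"
  shows "C1_on S f"
proof -
  have "times_differentiable_on 1 S f"
    using assms by (simp add: smooth_on_def)
  then show ?thesis
    by (intro C1_onI[where f' = "\<lambda>x. frechet_derivative f (at x)"])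
      (auto simp: frechet_derivative_works)
qed

lemma C1_on_const: "C1_on S (\<lambda>x. c)"
  by (rule C1_onI[where f' = "\<lambda>_ _. 0"]) auto

lemma C1_on_id: "C1_on S (\<lambda>x. x)"
  by (rule C1_onI[where f' = "\<lambda>_ v. v"]) auto

lemma C1_on_linear:
  assumes "bounded_linear L" "C1_on S f"
  shows "C1_on S (\<lambda>x. L (f x))"
proof -
  obtain f' where f': "\<And>x. x \<in> S \<Longrightarrow> (f has_derivative f' x) (at x)"
    "\<And>v. continuous_on S (\<lambda>x. f' x v)"
    using assms(2) by (elim C1_onE) blast
  show ?thesis
    by (rule C1_onI[where f' = "\<lambda>x v. L (f' x v)"])
      (auto intro!: bounded_linear.has_derivative[OF assms(1)] f'
        bounded_linear.continuous_on[OF assms(1)])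
qed

lemma C1_on_add:
  assumes "C1_on S f" "C1_on S g"
  shows "C1_on S (\<lambda>x. f x + g x)"
proof -
  obtain f' g' where "\<And>x. x \<in> S \<Longrightarrow> (f has_derivative f' x) (at x)"
    "\<And>v. continuous_on S (\<lambda>x. f' x v)" "\<And>x. x \<in> S \<Longrightarrow> (g has_derivative g' x) (at x)"
    "\<And>v. continuous_on S (\<lambda>x. g' x v)"
    using assms by (elim C1_onE) blast
  then show ?thesis
    by (intro C1_onI[where f' = "\<lambda>x v. f' x v + g' x v"]) (auto intro!: derivative_intros continuous_intros)
qed

lemma C1_on_minus: "C1_on S f \<Longrightarrow> C1_on S (\<lambda>x. - f x)"
  using C1_on_linear[OF bounded_linear_minus[OF bounded_linear_ident]] .

lemma C1_on_bilinear:
  assumes "bounded_bilinear mul" "C1_on S f" "C1_on S g"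
  shows "C1_on S (\<lambda>x. mul (f x) (g x))"
proof -
  obtain f' g' where "\<And>x. x \<in> S \<Longrightarrow> (f has_derivative f' x) (at x)"
    "\<And>v. continuous_on S (\<lambda>x. f' x v)" "\<And>x. x \<in> S \<Longrightarrow> (g has_derivative g' x) (at x)"
    "\<And>v. continuous_on S (\<lambda>x. g' x v)"
    using assms(2,3) by (elim C1_onE) blast
  moreover have "continuous_on S f" "continuous_on S g"
    using assms C1_on_continuous_on by auto
  ultimately show ?thesis
    by (intro C1_onI[where f' = "\<lambda>x v. mul (f x) (g' x v) + mul (f' x v) (g x)"])
      (auto intro!: bounded_bilinear.FDERIV[OF assms(1)] continuous_intros
        bounded_bilinear.continuous_on[OF assms(1)])
qed

lemmas C1_on_mult = C1_on_bilinear[OF bounded_bilinear_mult]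
  and C1_on_scaleR = C1_on_bilinear[OF bounded_bilinear_scaleR]

lemma C1_on_sum: "(\<And>i. i \<in> I \<Longrightarrow> C1_on S (f i)) \<Longrightarrow> C1_on S (\<lambda>x. \<Sum>i\<in>I. f i x)"
  by (induction I rule: infinite_finite_induct) (auto intro!: C1_on_const C1_on_add)

lemma C1_on_prod:
  fixes f :: "'i \<Rightarrow> 'a::real_normed_vector \<Rightarrow> real"
  shows "(\<And>i. i \<in> I \<Longrightarrow> C1_on S (f i)) \<Longrightarrow> C1_on S (\<lambda>x. \<Prod>i\<in>I. f i x)"
  by (induction I rule: infinite_finite_induct) (auto intro!: C1_on_const C1_on_mult)

lemma C1_on_inverse:
  fixes f :: "'a::real_normed_vector \<Rightarrow> real"
  assumes "C1_on S f" "\<And>x. x \<in> S \<Longrightarrow> f x \<noteq> 0"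
  shows "C1_on S (\<lambda>x. inverse (f x))"
proof -
  obtain f' where "\<And>x. x \<in> S \<Longrightarrow> (f has_derivative f' x) (at x)"
    "\<And>v. continuous_on S (\<lambda>x. f' x v)"
    using assms(1) by (elim C1_onE) blast
  moreover have "continuous_on S f"
    using assms C1_on_continuous_on by auto
  ultimately show ?thesis using assms(2)
    by (intro C1_onI[where f' = "\<lambda>x v. - (inverse (f x) * f' x v * inverse (f x))"])
      (auto intro!: has_derivative_inverse continuous_intros)
qed

lemma C1_on_Pair:
  assumes "C1_on S f" "C1_on S g"
  shows "C1_on S (\<lambda>x. (f x, g x))"
proof -
  obtain f' g' where "\<And>x. x \<in> S \<Longrightarrow> (f has_derivative f' x) (at x)"
    "\<And>v. continuous_on S (\<lambda>x. f' x v)" "\<And>x. x \<in> S \<Longrightarrow> (g has_derivative g' x) (at x)"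
    "\<And>v. continuous_on S (\<lambda>x. g' x v)"
    using assms by (elim C1_onE) blast
  then show ?thesis
    by (intro C1_onI[where f' = "\<lambda>x v. (f' x v, g' x v)"]) (auto intro!: has_derivative_Pair continuous_intros)
qed

lemma C1_on_matrix:
  assumes "\<And>i j. C1_on S (\<lambda>x. f x i j)"
  shows "C1_on S (\<lambda>x. (\<chi> i j. f x i j) :: real^'n^'m)"
proof -
  have if_sum: "(\<Sum>b\<in>B. if P then g b else 0) = (if P then \<Sum>b\<in>B. g b else (0::real))"
    for P B and g :: "'n \<Rightarrow> real"
    by simp
  \<comment> \<open>A matrix is a finite combination of constant unit matrices, so the rules for
    sums and scalings apply.\<close>
  have "(\<chi> i j. f x i j) = (\<Sum>i\<in>UNIV. \<Sum>j\<in>UNIV. f x i j *\<^sub>R (axis i (axis j 1) :: real^'n^'m))" for x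
    by (simp add: Finite_Cartesian_Product.vec_eq_iff axis_def if_sum
        if_distrib[of "\<lambda>y. y $ _"] if_distrib[of "\<lambda>y. _ * y"] cong: if_cong)
  then show ?thesis
    by (simp only:) (intro C1_on_sum C1_on_scaleR assms C1_on_const)
qed

text \<open>Leibniz formula with the entries given by a plain function: the determinant becomes a
  polynomial in the entries, to which the rules for sums and products apply.\<close>

lemma det_mat_eq:
  "Determinant.det (Matrix.mat m m (\<lambda>(i, j). g i j)) =
    (\<Sum>p | p permutes {0..<m}. signof p * (\<Prod>i = 0..<m. g i (p i)))"
  by (subst det_def'[where n = m]) (auto intro!: sum.cong prod.cong dest: permutes_in_image)

lemma C1_on_det:
  assumes "\<And>i j. i < m \<Longrightarrow> j < m \<Longrightarrow> C1_on S (\<lambda>x. f x i j)"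
  shows "C1_on S (\<lambda>x. Determinant.det (Matrix.mat m m (\<lambda>(i, j). f x i j)) :: real)"
  unfolding det_mat_eq
  by (intro C1_on_sum C1_on_mult C1_on_const C1_on_prod)
    (auto intro!: assms dest: permutes_in_image)

lemma continuous_on_det:
  assumes "\<And>i j. i < m \<Longrightarrow> j < m \<Longrightarrow> continuous_on S (\<lambda>x. f x i j)"
  shows "continuous_on S (\<lambda>x. Determinant.det (Matrix.mat m m (\<lambda>(i, j). f x i j)) :: real)"
  unfolding det_mat_eq
  by (intro continuous_on_sum continuous_on_mult continuous_on_const continuous_on_prod)
    (auto intro!: assms dest: permutes_in_image)

section \<open>Cramer's rule\<close>

text \<open>The candidate solution of \<open>A x = b\<close> as adjugate times \<open>b\<close> over
  the determinant. In this form it is visibly a rational function of the data.\<close>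

definition cramer :: "nat \<Rightarrow> (nat \<Rightarrow> nat \<Rightarrow> real) \<Rightarrow> (nat \<Rightarrow> real) \<Rightarrow> nat \<Rightarrow> real" where
  "cramer m A b i = (\<Sum>k<m. adj_mat (Matrix.mat m m (\<lambda>(u, v). A u v)) $$ (i, k) * b k)
     * inverse (Determinant.det (Matrix.mat m m (\<lambda>(u, v). A u v)))"

lemma mat_mult_vec_eq_iff:
  "(\<forall>u<m. (\<Sum>v<m. A u v * x v) = b u) \<longleftrightarrow>
   Matrix.mat m m (\<lambda>(u, v). A u v) *\<^sub>v Matrix.vec m x = Matrix.vec m b"
  by (auto simp: Matrix.vec_eq_iff Matrix.scalar_prod_def lessThan_atLeast0)

lemma smult_one_mat_mult_vec:
  assumes "x \<in> carrier_vec m"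
  shows "(c \<cdot>\<^sub>m 1\<^sub>m m) *\<^sub>v x = c \<cdot>\<^sub>v (x :: real Matrix.vec)"
proof (rule eq_vecI)
  fix i assume "i < dim_vec (c \<cdot>\<^sub>v x)"
  then have "i < m" using assms by simp
  then show "vec_index ((c \<cdot>\<^sub>m 1\<^sub>m m) *\<^sub>v x) i = vec_index (c \<cdot>\<^sub>v x) i"
    using assms by simp
qed (use assms in simp)

text \<open>Both directions come from \<open>M * adj M = adj M * M = det M I\<close>. As an
  equivalence it yields existence and uniqueness together, which the definite descriptions below
  require.\<close>

lemma cramer_iff:
  assumes det: "Determinant.det (Matrix.mat m m (\<lambda>(u, v). A u v)) \<noteq> (0::real)"
  shows "(\<forall>u<m. (\<Sum>v<m. A u v * x v) = b u) \<longleftrightarrow> (\<forall>v<m. x v = cramer m A b v)"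
proof -
  define M where "M = Matrix.mat m m (\<lambda>(u, v). A u v)"
  define D where "D = Determinant.det M"
  have M: "M \<in> carrier_mat m m" by (simp add: M_def)
  note adj = adj_mat[OF M, folded D_def]
  have D: "D \<noteq> 0" using det by (simp add: D_def M_def)
  define c where "c = Matrix.vec m (cramer m A b)"
  have c: "c = inverse D \<cdot>\<^sub>v (adj_mat M *\<^sub>v Matrix.vec m b)"
    using adj(1) by (auto simp: c_def cramer_def Matrix.vec_eq_iff Matrix.scalar_prod_def
        lessThan_atLeast0 D_def M_def)
  have "M *\<^sub>v Matrix.vec m x = Matrix.vec m b \<longleftrightarrow> Matrix.vec m x = c"
  proof
    assume "M *\<^sub>v Matrix.vec m x = Matrix.vec m b"
    then have "adj_mat M *\<^sub>v Matrix.vec m b = (adj_mat M * M) *\<^sub>v Matrix.vec m x"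
      using M adj(1) by (simp add: assoc_mult_mat_vec[of _ m m _ m])
    then show "Matrix.vec m x = c"
      using D by (simp add: c adj(3) smult_one_mat_mult_vec smult_smult_assoc)
  next
    assume "Matrix.vec m x = c"
    then have "M *\<^sub>v Matrix.vec m x = inverse D \<cdot>\<^sub>v (M *\<^sub>v (adj_mat M *\<^sub>v Matrix.vec m b))"
      using M adj(1) by (simp add: c mult_mat_vec[of _ m m])
    also have "M *\<^sub>v (adj_mat M *\<^sub>v Matrix.vec m b) = (M * adj_mat M) *\<^sub>v Matrix.vec m b"
      using M adj(1) by (simp add: assoc_mult_mat_vec[of _ m m _ m])
    finally show "M *\<^sub>v Matrix.vec m x = Matrix.vec m b"
      using D by (simp add: adj(2) smult_one_mat_mult_vec smult_smult_assoc)
  qed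
  then show ?thesis
    unfolding mat_mult_vec_eq_iff M_def[symmetric] by (auto simp: c_def Matrix.vec_eq_iff)
qed

text \<open>Adjugate entries are signed minors, that is, determinants of the same kind, and the only
  denominator is the nonvanishing determinant.\<close>

lemma C1_on_cramer:
  assumes A: "\<And>u v. u < m \<Longrightarrow> v < m \<Longrightarrow> C1_on S (\<lambda>x. A x u v)"
    and b: "\<And>u. u < m \<Longrightarrow> C1_on S (\<lambda>x. b x u)"
    and det: "\<And>x. x \<in> S \<Longrightarrow> Determinant.det (Matrix.mat m m (\<lambda>(u, v). A x u v)) \<noteq> 0"
    and i: "i < m"
  shows "C1_on S (\<lambda>x. cramer m (A x) (b x) i)"
proof -
  \<comment> \<open>The adjugate transposes: entry \<open>(i, k)\<close> deletes row
    \<open>k\<close> and column \<open>i\<close>, so indices from there on move up by one.\<close>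
  have adj: "adj_mat (Matrix.mat m m (\<lambda>(u, v). A x u v)) $$ (i, k) =
      (-1) ^ (k + i) * Determinant.det (Matrix.mat (m - 1) (m - 1)
        (\<lambda>(u, v). A x (if u < k then u else Suc u) (if v < i then v else Suc v)))"
    if "k < m" for x k
    using that i unfolding adj_mat_def cofactor_def
    by (auto simp: mat_delete_def intro!: arg_cong[where f = Determinant.det] eq_matI)
  show ?thesis
    unfolding cramer_def
    by (intro C1_on_mult C1_on_inverse C1_on_sum C1_on_det A det b)
      (auto simp: adj intro!: b C1_on_mult C1_on_const C1_on_det A)
qed

section \<open>Matrices of linear maps on phase space\<close>

lemma set_phase_basis: "set (phase_basis :: 'n::{finite,linorder} phase list) = Basis"
proof -
  have vec: "(Basis :: 'n mat2 set) = (\<Union>a\<in>{1, 2}. \<Union>k. {axis a (axis k 1)})"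
    by (simp add: Basis_vec_def UNIV_2)
  show ?thesis
    unfolding phase_basis_def Basis_prod_def vec by auto
qed

text \<open>By counting: the list has length \<open>4 n\<close>, which is also the dimension of
  phase space.\<close>

lemma distinct_phase_basis: "distinct (phase_basis :: 'n::{finite,linorder} phase list)"
  by (rule card_distinct) (simp add: set_phase_basis length_phase_basis DIM_prod)

lemma sum_phase_basis:
  "(\<Sum>i<4 * CARD('n). f (phase_basis ! i :: 'n::{finite,linorder} phase)) = (\<Sum>b\<in>Basis. f b)"
  by (rule sum.reindex_bij_betw)
    (rule bij_betw_nth[OF distinct_phase_basis], simp_all add: length_phase_basis set_phase_basis)

lemma dim_phase_mat [simp]:
  "dim_row (phase_mat (L :: 'n::{finite,linorder} phase \<Rightarrow> 'n phase)) = 4 * CARD('n)"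
  "dim_col (phase_mat (L :: 'n phase \<Rightarrow> 'n phase)) = 4 * CARD('n)"
  by (simp_all add: phase_mat_def)

lemma phase_mat_carrier [simp]:
  "phase_mat (L :: 'n::{finite,linorder} phase \<Rightarrow> 'n phase) \<in> carrier_mat (4 * CARD('n)) (4 * CARD('n))"
  by (rule carrier_matI) auto

lemma phase_vec_carrier [simp]:
  "phase_vec (v :: 'n::{finite,linorder} phase) \<in> carrier_vec (4 * CARD('n))"
  by (simp add: phase_vec_def)

text \<open>Expansion of \<open>v\<close> in the orthonormal basis; this is the row-times-column
  formula behind \<open>phase_mat_comp\<close> and \<open>phase_mat_vec\<close>.\<close>

lemma linear_inner_expand:
  assumes "linear (L :: 'a::euclidean_space \<Rightarrow> 'a)"
  shows "L v \<bullet> w = (\<Sum>b\<in>Basis. (L b \<bullet> w) * (v \<bullet> b))"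
proof -
  have "L v = L (\<Sum>b\<in>Basis. (v \<bullet> b) *\<^sub>R b)" by (simp add: euclidean_representation)
  also have "\<dots> = (\<Sum>b\<in>Basis. (v \<bullet> b) *\<^sub>R L b)"
    using assms by (simp add: linear_sum linear_scale)
  finally show ?thesis by (simp add: inner_sum_left mult.commute)
qed

text \<open>The expansion concerns the vectors \<open>L' b\<close> for basis vectors
  \<open>b\<close>, so \<open>L'\<close> may be any map. This allows
  \<open>L' = inv_into UNIV A \<circ> Z\<close> later without first showing that the inverse is
  linear.\<close>

lemma phase_mat_comp:
  assumes "linear (L :: 'n::{finite,linorder} phase \<Rightarrow> 'n phase)"
  shows "phase_mat (L \<circ> L') = phase_mat L * phase_mat L'"
  by (rule eq_matI)
    (simp_all add: phase_mat_def Matrix.scalar_prod_def linear_inner_expand[OF assms, of "L' _"]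
      sum_phase_basis[symmetric] lessThan_atLeast0)

lemma phase_mat_vec:
  assumes "linear (L :: 'n::{finite,linorder} phase \<Rightarrow> 'n phase)"
  shows "phase_mat L *\<^sub>v phase_vec v = phase_vec (L v)"
  by (rule eq_vecI)
    (simp_all add: phase_mat_def phase_vec_def Matrix.scalar_prod_def linear_inner_expand[OF assms, of v]
      sum_phase_basis[symmetric] lessThan_atLeast0)

lemma phase_vec_eq_0_iff: "phase_vec (v :: 'n::{finite,linorder} phase) = 0\<^sub>v (4 * CARD('n)) \<longleftrightarrow> v = 0"
proof
  assume *: "phase_vec v = 0\<^sub>v (4 * CARD('n))"
  have "v \<bullet> b = 0" if "b \<in> Basis" for b
  proof -
    obtain i where i: "i < 4 * CARD('n)" "phase_basis ! i = b"
      using \<open>b \<in> Basis\<close> by (metis in_set_conv_nth length_phase_basis set_phase_basis)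
    have "vec_index (phase_vec v) i = 0" using * i by simp
    then show ?thesis using i by (simp add: phase_vec_def)
  qed
  then show "v = 0" using euclidean_all_zero_iff by blast
qed (auto simp: phase_vec_def)

text \<open>A nonzero kernel vector of \<open>L\<close> would be a nonzero kernel vector of its
  matrix; in finite dimension injectivity then gives surjectivity.\<close>

lemma bij_if_det_phase_mat:
  assumes L: "linear (L :: 'n::{finite,linorder} phase \<Rightarrow> 'n phase)"
    and det: "Determinant.det (phase_mat L) \<noteq> 0"
  shows "bij L"
proof -
  have "v = 0" if "L v = 0" for v
  proof (rule ccontr)
    assume "v \<noteq> 0"
    then have "phase_vec v \<noteq> 0\<^sub>v (4 * CARD('n))" "phase_mat L *\<^sub>v phase_vec v = 0\<^sub>v (4 * CARD('n))"
      using that by (simp_all add: phase_mat_vec[OF L] phase_vec_eq_0_iff)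
    with det show False
      using det_0_iff_vec_prod_zero[OF phase_mat_carrier, of L] phase_vec_carrier by blast
  qed
  then have "inj L" using linear_injective_0[OF L] by blast
  then show ?thesis using linear_injective_imp_surjective[OF L] by (simp add: bij_def)
qed

text \<open>Multiplying by \<open>det A\<close> avoids the inverse in \<open>M = A\<^sup>-\<^sup>1 Z\<close>.\<close>

lemma det_phase_mat_pencil:
  fixes A Z :: "'n::{finite,linorder} phase \<Rightarrow> 'n phase"
  assumes A: "linear A" and det: "Determinant.det (phase_mat A) \<noteq> 0"
  shows "Determinant.det (phase_mat (\<lambda>v. x *\<^sub>R A v - Z v)) =
    Determinant.det (phase_mat A) * poly (char_poly (phase_mat (inv_into UNIV A \<circ> Z))) x"
proof -
  let ?m = "4 * CARD('n)"
  define M where "M = phase_mat (inv_into UNIV A \<circ> Z)"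
  have M: "M \<in> carrier_mat ?m ?m" by (simp add: M_def)
  have "A \<circ> (inv_into UNIV A \<circ> Z) = Z"
    using bij_if_det_phase_mat[OF A det] by (simp add: fun_eq_iff bij_is_surj surj_f_inv_f)
  then have AM: "phase_mat A * M = phase_mat Z"
    using phase_mat_comp[OF A, of "inv_into UNIV A \<circ> Z"] by (simp add: M_def)
  \<comment> \<open>\<open>char_matrix M x\<close> stands for \<open>M - x I\<close>; its negative
    is the matrix whose determinant is the characteristic polynomial at \<open>x\<close>.\<close>
  have "phase_mat A * (- char_matrix M x) = phase_mat A * (x \<cdot>\<^sub>m 1\<^sub>m ?m - M)"
    using M by (intro arg_cong[where f = "(*) (phase_mat A)"] eq_matI) (auto simp: char_matrix_def)
  also have "\<dots> = x \<cdot>\<^sub>m phase_mat A - phase_mat Z"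
    using M AM by (simp add: mult_minus_distrib_mat[of _ ?m ?m _ ?m] mult_smult_distrib[of _ ?m ?m _ ?m])
  also have "\<dots> = phase_mat (\<lambda>v. x *\<^sub>R A v - Z v)"
    by (rule eq_matI) (simp_all add: phase_mat_def inner_diff_left)
  finally show ?thesis
    using M unfolding M_def[symmetric] char_poly_matrix[OF M]
    by (subst det_mult[symmetric, of _ ?m]) (auto simp: char_matrix_def)
qed

text \<open>Two polynomials of degree below \<open>card X\<close> that agree on \<open>X\<close>
  coincide. The formula reduces control of a polynomial at \<open>t\<close> to its values at fixed
  nodes.\<close>

lemma lagrange_interpolation:
  fixes p :: "'a::field poly"
  assumes "finite X" "degree p < card X"
  shows "poly p t = (\<Sum>x\<in>X. poly p x * (\<Prod>y\<in>X - {x}. (t - y) / (x - y)))"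
proof -
  define q where "q = (\<Sum>x\<in>X. Polynomial.smult (poly p x) (\<Prod>y\<in>X - {x}. Polynomial.smult (inverse (x - y)) [:-y, 1:]))"
  have q: "poly q t = (\<Sum>x\<in>X. poly p x * (\<Prod>y\<in>X - {x}. (t - y) / (x - y)))" for t
    unfolding q_def poly_sum poly_smult poly_prod
    by (intro sum.cong refl arg_cong2[where f = "(*)"] prod.cong) (simp add: divide_inverse)
  have "degree q \<le> card X - 1"
    unfolding q_def
  proof (intro degree_sum_le assms)
    fix x assume x: "x \<in> X"
    have "degree (\<Prod>y\<in>X - {x}. Polynomial.smult (inverse (x - y)) [:-y, 1:]) \<le>
        sum (degree \<circ> (\<lambda>y. Polynomial.smult (inverse (x - y)) [:-y, 1:])) (X - {x})"
      by (intro degree_prod_sum_le) (use assms in auto)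
    also have "\<dots> \<le> sum (\<lambda>_. 1) (X - {x})"
      by (intro sum_mono) (auto intro: order.trans[OF degree_smult_le])
    also have "\<dots> = card X - 1" using x assms by simp
    finally show "degree (Polynomial.smult (poly p x) (\<Prod>y\<in>X - {x}. Polynomial.smult (inverse (x - y)) [:-y, 1:])) \<le> card X - 1"
      using degree_smult_le order.trans by blast
  qed
  moreover have "poly p x = poly q x" if x: "x \<in> X" for x
  proof -
    have "poly q x = (\<Sum>z\<in>X. if z = x then poly p z else 0)"
      unfolding q
    proof (intro sum.cong refl)
      fix z assume "z \<in> X"
      show "poly p z * (\<Prod>y\<in>X - {z}. (x - y) / (z - y)) = (if z = x then poly p z else 0)"
        using x assms by (auto simp: prod_zero_iff)
    qed
    then show ?thesis using x assms by simp
  qed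
  ultimately have "p = q"
    using assms by (intro poly_eqI_degree[where A = X]) auto
  then show ?thesis using q by metis
qed

section \<open>The linear systems defining the parametrization\<close>

lemma res_in: "1 \<le> i \<Longrightarrow> 1 \<le> n \<Longrightarrow> res n i \<in> {1..n}"
  by (simp add: res_eq Suc_le_eq)

lemma res_id: "1 \<le> i \<Longrightarrow> i \<le> n \<Longrightarrow> res n i = i"
  by (simp add: res_eq)

text \<open>Showing that the predicate amounts to equality with an explicit family settles
  existence, uniqueness and value of \<open>THE\<close> at once.\<close>

lemma the_eq_if_iff: "(\<And>x. Q x \<longleftrightarrow> x = a) \<Longrightarrow> (THE x. Q x) = a"
  by simp

text \<open>For \<open>i \<le> n\<close> the residue is \<open>i\<close> itself, so after moving the
  prescribed vectors to the right-hand side each of the two components solves an \<open>n\<close> by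
  \<open>n\<close> system with determinant \<open>Delta\<close>. The shift \<open>i - 1\<close>
  passes to matrix indices starting at 0.\<close>

lemma p_family_eq:
  assumes n: "n \<ge> 1" and Delta: "Delta n X \<noteq> 0"
  shows "p_family n P X = (\<lambda>i. if i \<in> {1..n} then
      \<chi> a. cramer n (\<lambda>u v. alpha (Suc v) (X (Suc v)) (Suc u))
        (\<lambda>u. - (\<Sum>j=n+1..2*n+1. P j $ a * alpha (res n j) (X j) (Suc u))) (i - 1)
    else if i \<in> {n+1..2*n+1} then P i else 0)" (is "_ = ?p")
  unfolding p_family_def
proof (rule the_eq_if_iff)
  fix p :: "nat \<Rightarrow> real^2"
  define A where "A = (\<lambda>u v. alpha (Suc v) (X (Suc v)) (Suc u))"
  define b where "b a = (\<lambda>u. - (\<Sum>j=n+1..2*n+1. P j $ a * alpha (res n j) (X j) (Suc u)))" for a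
  have det: "Determinant.det (Matrix.mat n n (\<lambda>(u, v). A u v)) \<noteq> 0"
    using Delta by (simp add: Delta_def A_def)
  have split: "(\<Sum>i=1..2*n+1. p i $ a * alpha (res n i) (X i) (Suc u)) =
      (\<Sum>v<n. A u v * p (Suc v) $ a) - b a u"
    if "\<forall>i\<in>{n+1..2*n+1}. p i = P i" for a u
  proof -
    have "{1..2*n+1} = {1..n} \<union> {n+1..2*n+1}" by auto
    then have "(\<Sum>i=1..2*n+1. p i $ a * alpha (res n i) (X i) (Suc u)) =
        (\<Sum>i=1..n. p i $ a * alpha (res n i) (X i) (Suc u))
        + (\<Sum>i=n+1..2*n+1. p i $ a * alpha (res n i) (X i) (Suc u))"
      by (simp only:) (intro sum.union_disjoint, auto)
    also have "(\<Sum>i=1..n. p i $ a * alpha (res n i) (X i) (Suc u)) = (\<Sum>v<n. A u v * p (Suc v) $ a)"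
      by (rule sum.reindex_bij_witness[of _ Suc "\<lambda>i. i - 1"]) (auto simp: A_def res_id)
    also have "(\<Sum>i=n+1..2*n+1. p i $ a * alpha (res n i) (X i) (Suc u)) = - b a u"
      unfolding b_def minus_minus using that by (intro sum.cong) auto
    finally show ?thesis by simp
  qed
  have range: "(\<forall>k\<in>{1..n}. R k) \<longleftrightarrow> (\<forall>u<n. R (Suc u))" for R
    unfolding image_Suc_lessThan[symmetric] by blast
  have "(\<forall>i. i \<notin> {1..2*n+1} \<longrightarrow> p i = 0) \<and> (\<forall>i\<in>{n+1..2*n+1}. p i = P i) \<and>
      (\<forall>a. \<forall>k\<in>{1..n}. (\<Sum>i=1..2*n+1. p i $ a * alpha (res n i) (X i) k) = 0) \<longleftrightarrow>
      (\<forall>i. i \<notin> {1..2*n+1} \<longrightarrow> p i = 0) \<and> (\<forall>i\<in>{n+1..2*n+1}. p i = P i) \<and>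
      (\<forall>a. \<forall>u<n. (\<Sum>v<n. A u v * p (Suc v) $ a) = b a u)"
    unfolding range
    by (rule conj_cong[OF refl], rule conj_cong[OF refl]) (simp only: split right_minus_eq)
  also have "\<dots> \<longleftrightarrow> p = (\<lambda>i. if i \<in> {1..n} then \<chi> a. cramer n A (b a) (i - 1)
      else if i \<in> {n+1..2*n+1} then P i else 0)" (is "_ \<longleftrightarrow> p = ?p'")
    unfolding cramer_iff[OF det]
  proof (intro iffI ext)
    fix i
    assume *: "(\<forall>i. i \<notin> {1..2*n+1} \<longrightarrow> p i = 0) \<and> (\<forall>i\<in>{n+1..2*n+1}. p i = P i) \<and>
      (\<forall>a. \<forall>v<n. p (Suc v) $ a = cramer n A (b a) v)"
    show "p i = ?p' i"
    proof (cases "i \<in> {1..n}")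
      case True
      then have "i - 1 < n" "Suc (i - 1) = i" by auto
      then have "p i $ a = cramer n A (b a) (i - 1)" for a using * by metis
      then show ?thesis using True by (simp add: Finite_Cartesian_Product.vec_eq_iff)
    next
      case False
      then show ?thesis using * unfolding if_not_P[OF False] by auto
    qed
  next
    assume "p = ?p'"
    then show "(\<forall>i. i \<notin> {1..2*n+1} \<longrightarrow> p i = 0) \<and> (\<forall>i\<in>{n+1..2*n+1}. p i = P i) \<and>
      (\<forall>a. \<forall>v<n. p (Suc v) $ a = cramer n A (b a) v)"
      by auto
  qed
  finally show "(\<forall>i. i \<notin> {1..2*n+1} \<longrightarrow> p i = 0) \<and> (\<forall>i\<in>{n+1..2*n+1}. p i = P i) \<and>
      (\<forall>a. \<forall>k\<in>{1..n}. (\<Sum>i=1..2*n+1. p i $ a * alpha (res n i) (X i) k) = 0) \<longleftrightarrow> p = ?p"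
    unfolding A_def b_def .
qed

text \<open>Linearity in \<open>y\<close>. The bounds on \<open>j\<close> and \<open>r\<close> keep
  every index in \<open>1..n-1\<close>, so the row depends on \<open>y\<close> only through these
  values.\<close>

lemma brow_expand:
  assumes "1 \<le> j" "j \<le> n" "1 \<le> r" "r \<le> n"
  shows "brow n r x y j = (\<Sum>l=1..n-1. y l * brow n r x (\<lambda>l'. if l' = l then 1 else 0) j)"
proof -
  consider "j < r" | "j = r" | "r < j" by linarith
  then show ?thesis
  proof cases
    case 2
    have "(\<Sum>l=1..n-1. x l * (if l = l' then 1 else 0)) = x l'" if "l' \<in> {1..n-1}" for l'
      using that by (simp add: if_distrib[of "\<lambda>y. _ * y"] cong: if_cong)
    then show ?thesis
      using 2 by (simp add: brow_def sum_negf[symmetric] mult.commute)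
  qed (use assms in \<open>auto simp: brow_def if_distrib[of "\<lambda>y. _ * y"] cong: if_cong\<close>)
qed

text \<open>The trace of \<open>b \<otimes> \<alpha>\<close>: at position \<open>r\<close> the entry
  \<open>-(x . y)\<close> meets the entry 1, and the other positions, shifted by one beyond
  \<open>r\<close>, add up to \<open>x . y\<close>.\<close>

lemma sum_brow_alpha:
  assumes "1 \<le> r" "r \<le> n"
  shows "(\<Sum>j=1..n. brow n r x y j * alpha r x j) = 0"
proof -
  have "{1..n} = insert r ({1..<r} \<union> {r<..n})" using assms by auto
  then have "(\<Sum>j=1..n. brow n r x y j * alpha r x j) =
      - (\<Sum>l=1..n-1. x l * y l) + (\<Sum>j\<in>{1..<r} \<union> {r<..n}. brow n r x y j * alpha r x j)"
    by (simp add: brow_def alpha_def)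
  also have "(\<Sum>j\<in>{1..<r} \<union> {r<..n}. brow n r x y j * alpha r x j) =
      (\<Sum>j\<in>{1..<r}. x j * y j) + (\<Sum>j\<in>{r<..n}. x (j - 1) * y (j - 1))"
    by (subst sum.union_disjoint) (auto simp: brow_def alpha_def mult.commute)
  also have "(\<Sum>j\<in>{r<..n}. x (j - 1) * y (j - 1)) = (\<Sum>j\<in>{r..n-1}. x j * y j)"
    by (rule sum.reindex_bij_witness[of _ Suc "\<lambda>j. j - 1"]) (use assms in auto)
  also have "(\<Sum>j\<in>{1..<r}. x j * y j) + (\<Sum>j\<in>{r..n-1}. x j * y j) = (\<Sum>l=1..n-1. x l * y l)"
    using assms by (subst sum.union_disjoint[symmetric]) (auto intro!: sum.cong)
  finally show ?thesis by simp
qed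

section \<open>Unknowns and equations of the system with determinant \<open>T\<close>\<close>

lemma T_dom_eq: "T_dom n = List.product [1..<n+2] [1..<n]"
  by (simp add: T_dom_def product_concat_map)

lemma distinct_T_dom: "distinct (T_dom n)"
  by (simp add: T_dom_eq distinct_product)

lemma set_T_dom: "set (T_dom n) = {1..n+1} \<times> {1..n-1}"
  by (auto simp: T_dom_eq)

lemma length_T_dom: "n \<ge> 1 \<Longrightarrow> length (T_dom n) = n\<^sup>2 - 1"
  by (simp add: T_dom_eq power2_eq_square algebra_simps)

lemma T_cod_eq: "T_cod n = filter (\<lambda>jk. jk \<noteq> (1, 1)) (List.product [1..<n+1] [1..<n+1])"
proof -
  have "concat (map (\<lambda>k. if (j, k) \<noteq> (1, 1) then [(j, k)] else []) ks) =
      filter (\<lambda>jk. jk \<noteq> (1, 1)) (map (Pair j) ks)" for j :: nat and ks :: "nat list"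
    by (induction ks) auto
  then show ?thesis
    unfolding T_cod_def product_concat_map filter_concat map_map o_def by simp
qed

lemma set_T_cod: "set (T_cod n) = {1..n} \<times> {1..n} - {(1, 1)}"
  by (auto simp: T_cod_eq)

text \<open>The number of equations matches the \<open>(n+1)(n-1)\<close> unknowns in
  \<open>T_dom\<close>, so the system is square.\<close>

lemma length_T_cod:
  assumes "n \<ge> 1"
  shows "length (T_cod n) = n\<^sup>2 - 1"
proof -
  have "distinct (T_cod n)" by (simp add: T_cod_eq distinct_product)
  then have "length (T_cod n) = card ({1..n} \<times> {1..n} - {(1, 1)})"
    by (metis distinct_card set_T_cod)
  also have "\<dots> = n\<^sup>2 - 1"
    using assms by (subst card_Diff_singleton) (auto simp: card_cartesian_product power2_eq_square)
  finally show ?thesis .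
qed

lemma T_map_expand:
  assumes n: "n \<ge> 1" and j: "j \<in> {1..n}"
  shows "T_map n X Y (j, k) = (\<Sum>v<n\<^sup>2 - 1. T_map n X (\<lambda>i l. if (i, l) = T_dom n ! v then 1 else 0) (j, k)
      * (case T_dom n ! v of (i, l) \<Rightarrow> Y i l))"
proof -
  define b where "b i l = brow n (res n i) (X i) (\<lambda>l'. if l' = l then 1 else 0) j" for i l
  define f where "f il = T_map n X (\<lambda>i l. if (i, l) = il then 1 else 0) (j, k)
      * (case il of (i, l) \<Rightarrow> Y i l)" for il
  \<comment> \<open>A unit vector in slot \<open>i\<close> leaves the zero row in every other slot,
    so only one summand of \<open>T_map\<close> survives.\<close>
  have f: "f (i, l) = Y i l * b i l * alpha (res n i) (X i) k" if i: "i \<in> {1..n+1}" for i l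
  proof -
    have "brow n r x (\<lambda>_. 0) j = 0" for r x by (simp add: brow_def)
    then have "brow n (res n i') (X i') (\<lambda>l'. if (i', l') = (i, l) then 1 else 0) j =
        (if i' = i then b i l else 0)" for i'
      by (simp add: b_def)
    then show ?thesis
      using i by (simp add: f_def T_map_def if_distrib[of "\<lambda>y. y * _"] cong: if_cong)
  qed
  have "T_map n X Y (j, k) = (\<Sum>i=1..n+1. \<Sum>l=1..n-1. f (i, l))"
    unfolding T_map_def prod.case
  proof (intro sum.cong refl)
    fix i assume i: "i \<in> {1..n+1}"
    have "brow n (res n i) (X i) (Y i) j = (\<Sum>l=1..n-1. Y i l * b i l)"
      unfolding b_def using res_in[of i n] i n j by (intro brow_expand) auto
    then show "brow n (res n i) (X i) (Y i) j * alpha (res n i) (X i) k = (\<Sum>l=1..n-1. f (i, l))"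
      by (simp add: f[OF i] sum_distrib_right)
  qed
  also have "\<dots> = (\<Sum>il\<in>set (T_dom n). f il)"
    unfolding set_T_dom by (simp add: sum.cartesian_product)
  also have "\<dots> = (\<Sum>v<n\<^sup>2 - 1. f (T_dom n ! v))"
    by (rule sum.reindex_bij_betw[symmetric])
      (rule bij_betw_nth[OF distinct_T_dom], simp_all add: length_T_dom[OF n])
  finally show ?thesis by (simp only: f_def)
qed

text \<open>With slots \<open>n+2..2n+1\<close> moved to the right-hand side and the
  \<open>(1,1)\<close> equation dropped, the remaining square system has determinant
  \<open>T\<close>. Unknowns are addressed by their position \<open>v\<close> in
  \<open>T_dom\<close>, hence the two separate conclusions.\<close>

lemma y_family_eq:
  fixes X Y n
  defines "m \<equiv> n\<^sup>2 - 1"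
  defines "A \<equiv> \<lambda>u v. T_map n X (\<lambda>i l. if (i, l) = T_dom n ! v then 1 else 0) (T_cod n ! u)"
  defines "b \<equiv> \<lambda>u. case T_cod n ! u of (j, k) \<Rightarrow>
    - (\<Sum>i=n+2..2*n+1. brow n (res n i) (X i) (Y i) j * alpha (res n i) (X i) k)"
  assumes n: "n \<ge> 1" and T: "T n X \<noteq> 0"
  shows "v < m \<Longrightarrow> T_dom n ! v = (i, l) \<Longrightarrow> y_family n X Y i l = cramer m A b v"
    and "i \<in> {n+2..2*n+1} \<Longrightarrow> l \<in> {1..n-1} \<Longrightarrow> y_family n X Y i l = Y i l"
proof -
  have det: "Determinant.det (Matrix.mat m m (\<lambda>(u, v). A u v)) \<noteq> 0"
    using T by (simp add: T_def m_def A_def)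
  \<comment> \<open>Inverse of the numbering: the position of a pair in
    \<open>T_dom\<close>.\<close>
  define idx where "idx = inv_into {..<m} ((!) (T_dom n))"
  have bij: "bij_betw ((!) (T_dom n)) {..<m} ({1..n+1} \<times> {1..n-1})"
    by (rule bij_betw_nth[OF distinct_T_dom]) (simp_all add: m_def length_T_dom[OF n] set_T_dom)
  have idx: "idx (T_dom n ! v) = v" if "v < m" for v
    using bij that by (simp add: idx_def bij_betw_def inv_into_f_f)
  have idx': "idx il < m \<and> T_dom n ! idx il = il" if "il \<in> {1..n+1} \<times> {1..n-1}" for il
    using bij that unfolding idx_def
    by (metis bij_betw_imp_surj_on f_inv_into_f inv_into_into lessThan_iff)
  define y0 where "y0 i l = (if (i, l) \<in> {1..n+1} \<times> {1..n-1} then cramer m A b (idx (i, l))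
    else if i \<in> {n+2..2*n+1} \<and> l \<in> {1..n-1} then Y i l else 0)" for i l
  have "y_family n X Y = y0"
    unfolding y_family_def
  proof (rule the_eq_if_iff)
    fix y :: "nat \<Rightarrow> nat \<Rightarrow> real"
    define E where "E j k = (\<Sum>i=1..2*n+1. brow n (res n i) (X i) (y i) j * alpha (res n i) (X i) k)" for j k
    \<comment> \<open>every summand has trace 0, so the (1,1) equation follows from the others\<close>
    have trace: "(\<Sum>j=1..n. E j j) = 0"
      unfolding E_def
    proof (subst sum.swap, rule sum.neutral, rule ballI)
      fix i assume "i \<in> {1..2*n+1}"
      then show "(\<Sum>j=1..n. brow n (res n i) (X i) (y i) j * alpha (res n i) (X i) j) = 0"
        using res_in[of i n] n by (intro sum_brow_alpha) auto
    qed
    have "E 1 1 = 0" if "\<forall>u<m. case T_cod n ! u of (j, k) \<Rightarrow> E j k = 0"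
    proof -
      have "E j j = 0" if "j \<in> {2..n}" for j
      proof -
        have "(j, j) \<in> set (T_cod n)" using that by (simp add: set_T_cod)
        then obtain u where "u < m" "T_cod n ! u = (j, j)"
          by (metis in_set_conv_nth length_T_cod[OF n] m_def)
        then show ?thesis using \<open>\<forall>u<m. _\<close> by force
      qed
      moreover have "{1..n} = insert 1 {2..n}" using n by auto
      ultimately show ?thesis using trace by simp
    qed
    then have E_iff: "(\<forall>j\<in>{1..n}. \<forall>k\<in>{1..n}. E j k = 0) \<longleftrightarrow> (\<forall>u<m. case T_cod n ! u of (j, k) \<Rightarrow> E j k = 0)"
    proof -
      have "(\<forall>u<m. case T_cod n ! u of (j, k) \<Rightarrow> E j k = 0) \<longleftrightarrow>
          (\<forall>(j, k)\<in>set (T_cod n). E j k = 0)"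
        by (simp only: all_set_conv_all_nth length_T_cod[OF n] m_def)
      then show ?thesis
        using \<open>(\<forall>u<m. _) \<Longrightarrow> _\<close> n unfolding set_T_cod by auto
    qed
    have split: "(case T_cod n ! u of (j, k) \<Rightarrow> E j k = 0) \<longleftrightarrow>
        (\<Sum>v<m. A u v * (case T_dom n ! v of (i, l) \<Rightarrow> y i l)) = b u"
      if y: "\<forall>i\<in>{n+2..2*n+1}. \<forall>l\<in>{1..n-1}. y i l = Y i l" and u: "u < m" for u
    proof -
      obtain j k where jk: "T_cod n ! u = (j, k)" by fastforce
      then have "(j, k) \<in> set (T_cod n)"
        using u by (metis length_T_cod[OF n] m_def nth_mem)
      then have j: "j \<in> {1..n}" by (simp add: set_T_cod)
      have "{1..2*n+1} = {1..n+1} \<union> {n+2..2*n+1}" using n by auto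
      then have "E j k = T_map n X y (j, k)
          + (\<Sum>i=n+2..2*n+1. brow n (res n i) (X i) (y i) j * alpha (res n i) (X i) k)"
        unfolding E_def T_map_def prod.case by (simp only:) (intro sum.union_disjoint, auto)
      also have "(\<Sum>i=n+2..2*n+1. brow n (res n i) (X i) (y i) j * alpha (res n i) (X i) k) = - b u"
        unfolding b_def jk prod.case minus_minus
      proof (intro sum.cong refl arg_cong2[where f = "(*)"])
        fix i assume i: "i \<in> {n+2..2*n+1}"
        then have r: "1 \<le> res n i" "res n i \<le> n" using res_in[of i n] n by auto
        \<comment> \<open>\<open>y\<close> and \<open>Y\<close> are known to agree only on
          \<open>1..n-1\<close>; by \<open>brow_expand\<close> no other values enter.\<close>
        show "brow n (res n i) (X i) (y i) j = brow n (res n i) (X i) (Y i) j"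
          using y i j r by (simp add: brow_expand[of j n "res n i" _ "y i"] brow_expand[of j n "res n i" _ "Y i"])
      qed
      finally show ?thesis
        using T_map_expand[OF n j, of X y k] by (simp add: A_def jk m_def)
    qed
    have "(\<forall>i l. \<not> (i \<in> {1..2*n+1} \<and> l \<in> {1..n-1}) \<longrightarrow> y i l = 0) \<and>
        (\<forall>i\<in>{n+2..2*n+1}. \<forall>l\<in>{1..n-1}. y i l = Y i l) \<and>
        (\<forall>j\<in>{1..n}. \<forall>k\<in>{1..n}. E j k = 0) \<longleftrightarrow>
        (\<forall>i l. \<not> (i \<in> {1..2*n+1} \<and> l \<in> {1..n-1}) \<longrightarrow> y i l = 0) \<and>
        (\<forall>i\<in>{n+2..2*n+1}. \<forall>l\<in>{1..n-1}. y i l = Y i l) \<and>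
        (\<forall>u<m. (\<Sum>v<m. A u v * (case T_dom n ! v of (i, l) \<Rightarrow> y i l)) = b u)"
      unfolding E_iff
      by (rule conj_cong[OF refl], rule conj_cong[OF refl], rule all_cong)
        (simp only: split)
    also have "\<dots> \<longleftrightarrow> y = y0"
      unfolding cramer_iff[OF det]
    proof (intro iffI ext)
      fix i l
      assume *: "(\<forall>i l. \<not> (i \<in> {1..2*n+1} \<and> l \<in> {1..n-1}) \<longrightarrow> y i l = 0) \<and>
        (\<forall>i\<in>{n+2..2*n+1}. \<forall>l\<in>{1..n-1}. y i l = Y i l) \<and>
        (\<forall>v<m. (case T_dom n ! v of (i, l) \<Rightarrow> y i l) = cramer m A b v)"
      show "y i l = y0 i l"
      proof (cases "(i, l) \<in> {1..n+1} \<times> {1..n-1}")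
        case True
        then have "(case T_dom n ! idx (i, l) of (i, l) \<Rightarrow> y i l) = cramer m A b (idx (i, l))"
          using * idx' by blast
        then show ?thesis using idx'[OF True] True by (simp add: y0_def)
      next
        case False
        then show ?thesis using * unfolding y0_def by auto
      qed
    next
      assume y: "y = y0"
      have "(case T_dom n ! v of (i, l) \<Rightarrow> y0 i l) = cramer m A b v" if "v < m" for v
      proof -
        obtain i l where il: "T_dom n ! v = (i, l)" by fastforce
        then have "(i, l) \<in> {1..n+1} \<times> {1..n-1}"
          using bij that by (metis bij_betw_apply lessThan_iff)
        then show ?thesis using idx[OF that] by (simp add: il y0_def)
      qed
      then show "(\<forall>i l. \<not> (i \<in> {1..2*n+1} \<and> l \<in> {1..n-1}) \<longrightarrow> y i l = 0) \<and>
        (\<forall>i\<in>{n+2..2*n+1}. \<forall>l\<in>{1..n-1}. y i l = Y i l) \<and>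
        (\<forall>v<m. (case T_dom n ! v of (i, l) \<Rightarrow> y i l) = cramer m A b v)"
        unfolding y by (auto simp: y0_def)
    qed
    finally show "(\<forall>i l. \<not> (i \<in> {1..2*n+1} \<and> l \<in> {1..n-1}) \<longrightarrow> y i l = 0) \<and>
        (\<forall>i\<in>{n+2..2*n+1}. \<forall>l\<in>{1..n-1}. y i l = Y i l) \<and>
        (\<forall>j\<in>{1..n}. \<forall>k\<in>{1..n}. (\<Sum>i=1..2*n+1. brow n (res n i) (X i) (y i) j
          * alpha (res n i) (X i) k) = 0) \<longleftrightarrow> y = y0"
      unfolding E_def .
  qed
  moreover have "y0 i l = cramer m A b v" if "v < m" "T_dom n ! v = (i, l)" for v i l
    using that idx[OF that(1)] bij_betw_apply[OF bij, of v] by (simp add: y0_def)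
  moreover have "y0 i l = Y i l" if "i \<in> {n+2..2*n+1}" "l \<in> {1..n-1}" for i l
    using that by (simp add: y0_def)
  ultimately show "v < m \<Longrightarrow> T_dom n ! v = (i, l) \<Longrightarrow> y_family n X Y i l = cramer m A b v"
    and "i \<in> {n+2..2*n+1} \<Longrightarrow> l \<in> {1..n-1} \<Longrightarrow> y_family n X Y i l = Y i l"
    by auto
qed

section \<open>Smooth dependence on the parameters\<close>

text \<open>The condition does not depend on the point, so nothing has to match across a
  boundary.\<close>

lemma C1_on_If:
  "(P \<Longrightarrow> C1_on S f) \<Longrightarrow> (\<not> P \<Longrightarrow> C1_on S g) \<Longrightarrow> C1_on S (\<lambda>x. if P then f x else g x)"
  by (cases P) simp_all

lemma set_coords:
  "set (coords n) = (\<Union>j\<in>{n+1..2*n+1}. {CP j 1, CP j 2})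
    \<union> (\<Union>i\<in>{1..2*n+1}. CX i ` {1..<n}) \<union> (\<Union>j\<in>{n+2..2*n+1}. CY j ` {1..<n})
    \<union> (\<Union>j\<in>{n+2..2*n+1}. CZ j ` {1..<n}) \<union> Cb ` {1..<n-1} \<union> Ckappa ` {1..2*n+1}"
  unfolding coords_def set_append set_concat set_map set_upt
  by (simp add: atLeastLessThanSuc_atLeastAtMost Un_assoc)

lemma in_set_coords:
  "CP j a \<in> set (coords n) \<longleftrightarrow> j \<in> {n+1..2*n+1}"
  "CX i l \<in> set (coords n) \<longleftrightarrow> i \<in> {1..2*n+1} \<and> l \<in> {1..<n}"
  "CY j l \<in> set (coords n) \<longleftrightarrow> j \<in> {n+2..2*n+1} \<and> l \<in> {1..<n}"
  "CZ j l \<in> set (coords n) \<longleftrightarrow> j \<in> {n+2..2*n+1} \<and> l \<in> {1..<n}"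
  "Cb l \<in> set (coords n) \<longleftrightarrow> l \<in> {1..<n-1}"
  "Ckappa i \<in> set (coords n) \<longleftrightarrow> i \<in> {1..2*n+1}"
proof -
  show "CP j a \<in> set (coords n) \<longleftrightarrow> j \<in> {n+1..2*n+1}"
    using exhaust_2[of a] unfolding set_coords by blast
qed (auto simp: set_coords image_iff)

lemma C1_on_alpha:
  assumes "\<And>l. l \<in> {1..n-1} \<Longrightarrow> C1_on S (\<lambda>\<rho>. x \<rho> l)" "1 \<le> r" "r \<le> n" "k \<in> {1..n}"
  shows "C1_on S (\<lambda>\<rho>. alpha r (x \<rho>) k)"
  using assms(2-4) unfolding alpha_def by (intro C1_on_If assms(1) C1_on_const) auto

lemma C1_on_brow:
  assumes "\<And>l. l \<in> {1..n-1} \<Longrightarrow> C1_on S (\<lambda>\<rho>. x \<rho> l)"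
    and "\<And>l. l \<in> {1..n-1} \<Longrightarrow> C1_on S (\<lambda>\<rho>. y \<rho> l)"
    and "1 \<le> r" "r \<le> n" "j \<in> {1..n}"
  shows "C1_on S (\<lambda>\<rho>. brow n r (x \<rho>) (y \<rho>) j)"
  using assms(3-5) unfolding brow_def
  by (intro C1_on_If assms(1,2) C1_on_minus C1_on_sum C1_on_mult) auto

lemma C1_on_brow_alpha:
  assumes "\<And>l. l \<in> {1..n-1} \<Longrightarrow> C1_on S (\<lambda>\<rho>. x \<rho> l)"
    and "\<And>l. l \<in> {1..n-1} \<Longrightarrow> C1_on S (\<lambda>\<rho>. y \<rho> l)"
    and "1 \<le> n" "1 \<le> i" "j \<in> {1..n}" "k \<in> {1..n}"
  shows "C1_on S (\<lambda>\<rho>. brow n (res n i) (x \<rho>) (y \<rho>) j * alpha (res n i) (x \<rho>) k)"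
proof -
  have "1 \<le> res n i" "res n i \<le> n" using res_in[of i n] assms by auto
  then show ?thesis
    by (intro C1_on_mult C1_on_brow C1_on_alpha[where n = n] assms)
qed

context
  fixes n :: nat and S :: "'a::real_normed_vector set" and U :: "'a \<Rightarrow> param"
  assumes n: "n \<ge> 2" and S: "open S"
    and U: "\<And>\<rho>. \<rho> \<in> S \<Longrightarrow> U \<rho> \<in> U_set n"
    and C1: "\<And>k. k \<in> set (coords n) \<Longrightarrow> C1_on S (\<lambda>\<rho>. U \<rho> k)"
begin

lemma C1_on_X: "i \<in> {1..2*n+1} \<Longrightarrow> l \<in> {1..n-1} \<Longrightarrow> C1_on S (\<lambda>\<rho>. X_of (U \<rho>) i l)"
  unfolding X_of_def by (rule C1) (auto simp: in_set_coords)

lemma C1_on_a_vec: "i \<in> {1..2*n+1} \<Longrightarrow> k \<in> {1..n} \<Longrightarrow> C1_on S (\<lambda>\<rho>. a_vec n (U \<rho>) i k)"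
  using res_in[of i n] n unfolding a_vec_def
  by (intro C1_on_alpha[where n = n] C1_on_X) auto

lemma C1_on_P: "j \<in> {n+1..2*n+1} \<Longrightarrow> C1_on S (\<lambda>\<rho>. P_of (U \<rho>) j $ a)"
  unfolding P_of_def vec_lambda_beta
  by (intro C1) (auto simp: in_set_coords)

text \<open>Membership in \<open>U_set n\<close> makes \<open>Delta\<close> nonzero on
  \<open>S\<close>, so Cramer's formula is valid there; openness of \<open>S\<close> carries the
  derivatives over from the formula.\<close>

lemma C1_on_p_vec: "C1_on S (\<lambda>\<rho>. p_vec n (U \<rho>) i $ a)"
proof -
  have Delta: "Delta n (X_of (U \<rho>)) \<noteq> 0" if "\<rho> \<in> S" for \<rho>
    using U[OF that] by (auto simp: U_set_def V_set_def)
  have alpha: "C1_on S (\<lambda>\<rho>. alpha (res n i) (X_of (U \<rho>) i) k)" if "i \<in> {1..2*n+1}" "k \<in> {1..n}" for i k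
    using C1_on_a_vec[OF that] by (simp add: a_vec_def)
  define A where "A X = (\<lambda>u v. alpha (Suc v) (X (Suc v)) (Suc u))" for X :: "nat \<Rightarrow> nat \<Rightarrow> real"
  define b where "b P X = (\<lambda>u. - (\<Sum>j=n+1..2*n+1. P j $ a * alpha (res n j) (X j) (Suc u)))"
    for P :: "nat \<Rightarrow> real^2" and X
  have "C1_on S (\<lambda>\<rho>. cramer n (A (X_of (U \<rho>))) (b (P_of (U \<rho>)) (X_of (U \<rho>))) (i - 1))" if "i \<in> {1..n}"
  proof (rule C1_on_cramer)
    fix u v assume "u < n" "v < n"
    then show "C1_on S (\<lambda>\<rho>. A (X_of (U \<rho>)) u v)"
      using alpha[of "Suc v" "Suc u"] by (simp add: A_def res_id)
  next
    fix u assume "u < n"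
    then show "C1_on S (\<lambda>\<rho>. b (P_of (U \<rho>)) (X_of (U \<rho>)) u)"
      unfolding b_def by (intro C1_on_minus C1_on_sum C1_on_mult C1_on_P alpha) auto
  next
    show "Determinant.det (Matrix.mat n n (\<lambda>(u, v). A (X_of (U \<rho>)) u v)) \<noteq> 0" if "\<rho> \<in> S" for \<rho>
      using Delta[OF that] by (simp add: A_def Delta_def)
  qed (use that in auto)
  moreover have "p_vec n (U \<rho>) i $ a = (if i \<in> {1..n} then
      cramer n (A (X_of (U \<rho>))) (b (P_of (U \<rho>)) (X_of (U \<rho>))) (i - 1)
      else if i \<in> {n+1..2*n+1} then P_of (U \<rho>) i $ a else 0)" if "\<rho> \<in> S" for \<rho>
    unfolding p_vec_def using n Delta[OF that] by (subst p_family_eq) (simp_all add: A_def b_def)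
  ultimately show ?thesis
    by - (rule C1_on_cong[OF S], assumption, intro C1_on_If C1_on_P C1_on_const)
qed

text \<open>Stated for a general family \<open>Y\<close> so that it serves both \<open>Y_of\<close>
  and \<open>Z_of\<close>. The denominator is \<open>T\<close>, nonzero on
  \<open>U_set n\<close>.\<close>

lemma C1_on_y_family:
  assumes Y: "\<And>i l. i \<in> {n+2..2*n+1} \<Longrightarrow> l \<in> {1..n-1} \<Longrightarrow> C1_on S (\<lambda>\<rho>. Y \<rho> i l)"
    and i: "i \<in> {1..2*n+1}" and l: "l \<in> {1..n-1}"
  shows "C1_on S (\<lambda>\<rho>. y_family n (X_of (U \<rho>)) (Y \<rho>) i l)"
proof -
  have T: "T n (X_of (U \<rho>)) \<noteq> 0" if "\<rho> \<in> S" for \<rho>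
    using U[OF that] by (auto simp: U_set_def V_set_def)
  have n1: "n \<ge> 1" using n by simp
  note y_eq = y_family_eq[OF n1 T]
  show ?thesis
  proof (cases "i \<in> {n+2..2*n+1}")
    case True
    then show ?thesis
      using y_eq(2) l by (intro C1_on_cong[OF S _ Y]) auto
  next
    case False
    then have "(i, l) \<in> set (T_dom n)" using i l by (simp add: set_T_dom)
    then obtain v where v: "v < n\<^sup>2 - 1" "T_dom n ! v = (i, l)"
      by (metis in_set_conv_nth length_T_dom[OF n1])
    show ?thesis
    proof (rule C1_on_cong[OF S y_eq(1)[OF _ v]], assumption, rule C1_on_cramer[OF _ _ _ v(1)])
      fix u assume u: "u < n\<^sup>2 - 1"
      obtain j k where jk: "T_cod n ! u = (j, k)" by fastforce
      then have "(j, k) \<in> set (T_cod n)"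
        using u by (metis length_T_cod[OF n1] nth_mem)
      then have jk_in: "j \<in> {1..n}" "k \<in> {1..n}" by (simp_all add: set_T_cod)
      show "C1_on S (\<lambda>\<rho>. case T_cod n ! u of (j, k) \<Rightarrow>
          - (\<Sum>i=n+2..2*n+1. brow n (res n i) (X_of (U \<rho>) i) (Y \<rho> i) j * alpha (res n i) (X_of (U \<rho>) i) k))"
        unfolding jk prod.case
        by (intro C1_on_minus C1_on_sum C1_on_brow_alpha C1_on_X Y jk_in) (use n in auto)
      show "C1_on S (\<lambda>\<rho>. T_map n (X_of (U \<rho>)) (\<lambda>i l. if (i, l) = T_dom n ! v then 1 else 0) (T_cod n ! u))" for v
        unfolding jk T_map_def prod.case
        by (intro C1_on_sum C1_on_brow_alpha C1_on_X C1_on_const jk_in) (use n in auto)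
    next
      show "Determinant.det (Matrix.mat (n\<^sup>2 - 1) (n\<^sup>2 - 1) (\<lambda>(u, v).
          T_map n (X_of (U \<rho>)) (\<lambda>i l. if (i, l) = T_dom n ! v then 1 else 0) (T_cod n ! u))) \<noteq> 0"
        if "\<rho> \<in> S" for \<rho>
        using T[OF that] by (simp add: T_def)
    qed
  qed
qed

lemma C1_on_B_mat:
  assumes i: "i \<in> {1..2*n+1}" and k: "k \<in> {1..n}"
  shows "C1_on S (\<lambda>\<rho>. B_mat n (U \<rho>) i a k)"
proof -
  have r: "1 \<le> res n i" "res n i \<le> n" using res_in[of i n] n i by auto
  have "C1_on S (\<lambda>\<rho>. Y_of (U \<rho>) i l)" "C1_on S (\<lambda>\<rho>. Z_of (U \<rho>) i l)"
    if "i \<in> {n+2..2*n+1}" "l \<in> {1..n-1}" for i l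
    unfolding Y_of_def Z_of_def using that by (auto intro!: C1 simp: in_set_coords)
  then have "C1_on S (\<lambda>\<rho>. brow n (res n i) (X_of (U \<rho>) i) (y_family n (X_of (U \<rho>)) (Y_of (U \<rho>)) i) k)"
    "C1_on S (\<lambda>\<rho>. brow n (res n i) (X_of (U \<rho>) i) (y_family n (X_of (U \<rho>)) (Z_of (U \<rho>)) i) k)"
    using i k r by (intro C1_on_brow C1_on_X C1_on_y_family; simp)+
  then show ?thesis unfolding B_mat_def beta_def by (intro C1_on_If)
qed

lemma C1_on_s_val:
  assumes "i \<in> {1..2*n+1}"
  shows "C1_on S (\<lambda>\<rho>. s_val n (U \<rho>) i)"
proof -
  have "C1_on S (\<lambda>\<rho>. q_vec (b_of (U \<rho>)) k)" if "k \<in> {1..n}" for k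
    unfolding q_vec_def b_of_def using that by (intro C1_on_If C1 C1_on_const) (auto simp: in_set_coords)
  then show ?thesis
    unfolding s_val_def using assms by (intro C1_on_sum C1_on_mult C1_on_a_vec) auto
qed

lemma C1_on_gamma:
  assumes "n = CARD('n::{finite,linorder})" "i \<in> {1..2*n+1}"
  shows "C1_on S (\<lambda>\<rho>. gamma (U \<rho>) i :: 'n phase)"
proof -
  have "pos (k :: 'n) \<in> {1..n}" for k
    using bij_betw_apply[OF pos_bij, of k] assms by simp
  then show ?thesis
    unfolding gamma_def assms(1)[symmetric] using assms(2)
    by (intro C1_on_Pair C1_on_matrix C1_on_mult C1_on_p_vec C1_on_a_vec C1_on_s_val C1_on_B_mat)
qed

end

lemma C1_on_pi_fun:
  fixes U :: "'n::{finite,linorder} phase \<Rightarrow> param"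
  assumes "CARD('n) \<ge> 2" "open S" "\<And>\<rho>. \<rho> \<in> S \<Longrightarrow> U \<rho> \<in> U_set CARD('n)"
    "\<And>k. k \<in> set (coords CARD('n)) \<Longrightarrow> C1_on S (\<lambda>\<rho>. U \<rho> k)"
    and "i \<in> {1..2 * CARD('n) + 1}"
  shows "C1_on S (pi_fun U i)"
  unfolding pi_fun_def using assms(5)
  by (intro C1_on_add C1_on_id C1_on_sum C1_on_gamma[OF assms(1-4)]) auto

lemma C1_on_z_fun:
  fixes U :: "'n::{finite,linorder} phase \<Rightarrow> param"
  assumes "CARD('n) \<ge> 2" "open S" "\<And>\<rho>. \<rho> \<in> S \<Longrightarrow> U \<rho> \<in> U_set CARD('n)"
    "\<And>k. k \<in> set (coords CARD('n)) \<Longrightarrow> C1_on S (\<lambda>\<rho>. U \<rho> k)"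
    and "i \<in> {1..2 * CARD('n) + 1}"
  shows "C1_on S (z_fun U i)"
  unfolding z_fun_def kappa_def using assms(5)
  by (intro C1_on_scaleR assms(4) C1_on_gamma[OF assms(1-4)]) (auto simp: in_set_coords)

section \<open>Openness and disjointness\<close>

lemma continuous_on_det_phase_mat:
  fixes L :: "'a::topological_space \<Rightarrow> 'n::{finite,linorder} phase \<Rightarrow> 'n phase"
  assumes "\<And>v. continuous_on S (\<lambda>\<rho>. L \<rho> v)"
  shows "continuous_on S (\<lambda>\<rho>. Determinant.det (phase_mat (L \<rho>)))"
  unfolding phase_mat_def by (intro continuous_on_det continuous_intros assms)

text \<open>Interpolation expresses \<open>poly (q x) s\<close> through finitely many values at
  fixed nodes, hence jointly continuously in \<open>(x, s)\<close>. Continuity is assumed at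
  positive arguments only: in the application the factors \<open>x^(n+1)\<close> and
  \<open>(x+1)^(2n)\<close> obstruct it at 0 and -1.\<close>

lemma eventually_poly_nonzero:
  fixes q :: "'a::t2_space \<Rightarrow> real poly"
  assumes S: "open S" "a \<in> S"
    and deg: "\<And>x. x \<in> S \<Longrightarrow> degree (q x) < n"
    and cont: "\<And>t. t > 0 \<Longrightarrow> continuous_on S (\<lambda>x. poly (q x) t)"
    and nz: "poly (q a) b \<noteq> 0"
  shows "\<forall>\<^sub>F (x, s) in nhds a \<times>\<^sub>F nhds b. poly (q x) s \<noteq> 0"
proof -
  \<comment> \<open>\<open>n\<close> distinct positive nodes, enough for degree below
    \<open>n\<close>.\<close>
  define X where "X = real ` {1..n}"
  have X: "finite X" "card X = n"
    by (simp_all add: X_def card_image)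
  define h where "h = (\<lambda>(x, s). \<Sum>t\<in>X. poly (q x) t * (\<Prod>y\<in>X - {t}. (s - y) / (t - y)))"
  have h: "poly (q x) s = h (x, s)" if "x \<in> S" for x s
    unfolding h_def prod.case using deg[OF that] X by (intro lagrange_interpolation) auto
  have "((\<lambda>x. poly (q x) t) \<longlongrightarrow> poly (q a) t) (nhds a)" if "t \<in> X" for t
  proof -
    have "isCont (\<lambda>x. poly (q x) t) a"
      using cont[of t] S that by (auto simp: continuous_on_eq_continuous_at X_def)
    then show ?thesis by (simp add: isCont_def tendsto_at_iff_tendsto_nhds[of "\<lambda>x. poly (q x) t" a])
  qed
  then have "((\<lambda>p. poly (q (fst p)) t) \<longlongrightarrow> poly (q a) t) (nhds a \<times>\<^sub>F nhds b)" if "t \<in> X" for t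
    using filterlim_compose[OF _ filterlim_fst] that by blast
  moreover have "(snd \<longlongrightarrow> b) (nhds a \<times>\<^sub>F nhds b)" by (rule filterlim_snd)
  ultimately have "(h \<longlongrightarrow> h (a, b)) (nhds a \<times>\<^sub>F nhds b)"
    unfolding h_def case_prod_beta fst_conv snd_conv
    by (intro tendsto_intros) (auto simp: X_def)
  moreover have "h (a, b) \<noteq> 0" using h[OF S(2)] nz by metis
  ultimately have "\<forall>\<^sub>F p in nhds a \<times>\<^sub>F nhds b. h p \<noteq> 0"
    by (rule tendsto_imp_eventually_ne)
  moreover have "\<forall>\<^sub>F p in nhds a \<times>\<^sub>F nhds b. fst p \<in> S"
    using eventually_nhds_in_open[OF S] filterlim_fst by (rule eventually_compose_filterlim)
  ultimately show ?thesis
    by eventually_elim (auto simp: h)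
qed

text \<open>By compactness the first components of \<open>f\<close> and \<open>g\<close> stay a
  distance \<open>d\<close> apart, while the two perturbations together move them by at most
  \<open>(1 - l) * (B + C)\<close>, which falls below \<open>d\<close>.\<close>

lemma eventually_disjoint_images:
  fixes f g u v :: "'a::topological_space \<Rightarrow> 'b::euclidean_space \<times> 'c::euclidean_space"
  assumes K: "compact K"
    and cont: "continuous_on K f" "continuous_on K g" "continuous_on K u" "continuous_on K v"
    and disj: "(fst \<circ> f) ` K \<inter> (fst \<circ> g) ` K = {}"
  shows "\<forall>\<^sub>F l in at_left (1::real).
    (\<lambda>x. f x - (1 - l) *\<^sub>R u x) ` K \<inter> (\<lambda>x. g x - (1 - l) *\<^sub>R v x) ` K = {}"
proof -
  have "compact ((fst \<circ> f) ` K)" "compact ((fst \<circ> g) ` K)"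
    using cont by (auto intro!: compact_continuous_image K continuous_intros simp: o_def)
  from separate_compact_closed[OF this(1) compact_imp_closed[OF this(2)] disj]
  obtain d where d: "d > 0" "\<And>x y. x \<in> (fst \<circ> f) ` K \<Longrightarrow> y \<in> (fst \<circ> g) ` K \<Longrightarrow> d \<le> dist x y"
    by blast
  have "bounded (u ` K)" "bounded (v ` K)"
    using cont by (auto intro!: compact_imp_bounded compact_continuous_image K)
  then obtain B C where B: "\<And>x. x \<in> K \<Longrightarrow> norm (u x) \<le> B" and C: "\<And>x. x \<in> K \<Longrightarrow> norm (v x) \<le> C"
    by (auto simp: bounded_iff)
  have "((\<lambda>l. (1 - l) * (B + C)) \<longlongrightarrow> (1 - 1) * (B + C)) (at_left (1::real))"
    by (intro tendsto_intros)
  then have "\<forall>\<^sub>F l in at_left (1::real). (1 - l) * (B + C) < d"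
    using d(1) by (intro order_tendstoD) auto
  moreover have "\<forall>\<^sub>F l in at_left (1::real). l < 1" by (simp add: eventually_at_filter)
  ultimately show ?thesis
  proof eventually_elim
    case (elim l)
    have False if x: "x \<in> K" and y: "y \<in> K" and eq: "f x - (1 - l) *\<^sub>R u x = g y - (1 - l) *\<^sub>R v y" for x y
    proof -
      have "fst (f x) - fst (g y) = (1 - l) *\<^sub>R (fst (u x) - fst (v y))"
        using arg_cong[OF eq, of fst] by (simp add: algebra_simps)
      then have "dist (fst (f x)) (fst (g y)) = (1 - l) * norm (fst (u x) - fst (v y))"
        using elim by (simp add: dist_norm)
      also have "\<dots> \<le> (1 - l) * (B + C)"
      proof (intro mult_left_mono)
        have "norm (fst (u x) - fst (v y)) \<le> norm (fst (u x)) + norm (fst (v y))"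
          by (rule norm_triangle_ineq4)
        also have "\<dots> \<le> B + C"
          using B[OF x] C[OF y] norm_fst_le[of "fst (u x)" "snd (u x)"] norm_fst_le[of "fst (v y)" "snd (v y)"]
          by simp
        finally show "norm (fst (u x) - fst (v y)) \<le> B + C" .
      qed (use elim in auto)
      also have "\<dots> < d" using elim by simp
      finally show False using d(2)[of "fst (f x)" "fst (g y)"] x y by auto
    qed
    then show ?case by blast
  qed
qed

text \<open>A surjective derivative has a linear right inverse, so Sussmann's open mapping theorem
  makes each image point interior.\<close>

lemma open_image_if_surj_derivative:
  fixes f :: "'a::euclidean_space \<Rightarrow> 'b::euclidean_space"
  assumes "open S" and f: "\<And>x. x \<in> S \<Longrightarrow> (f has_derivative f' x) (at x)" "\<And>x. x \<in> S \<Longrightarrow> surj (f' x)"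
  shows "open (f ` S)"
proof -
  have cont: "continuous_on S f"
    using f(1) has_derivative_continuous continuous_at_imp_continuous_on by blast
  have "f x \<in> interior (f ` S)" if x: "x \<in> S" for x
  proof -
    obtain g where g: "linear g" "f' x \<circ> g = id"
      using linear_surjective_right_inverse[OF has_derivative_linear[OF f(1)[OF x]] f(2)[OF x]] by blast
    show ?thesis
      by (rule sussmann_open_mapping[OF \<open>open S\<close> cont x f(1)[OF x] _ g(2) order_refl])
        (use g x \<open>open S\<close> in \<open>simp_all add: linear_conv_bounded_linear interior_open\<close>)
  qed
  then show ?thesis using interior_subset[of "f ` S"] by (metis image_subsetI open_interior subset_antisym)
qed

theorem proposition5p10:
  fixes mn :: "'d::finite \<Rightarrow> 'n::{finite,linorder} \<times> 'n"
    and n N :: nat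
    and U0 :: param
    and c :: "nat \<Rightarrow> real" and d :: "nat \<Rightarrow> real^'d"
    and \<epsilon> C0 r0 R :: real
    and G :: "'n mat2 \<times> (real^'d) \<Rightarrow> real"
    and \<zeta> F0 F :: "'n mat2 \<Rightarrow> real"
    and H0 Ht :: "nat \<Rightarrow> 'n tensor4"
    and U :: "'n phase \<Rightarrow> param"
    and Q :: "nat \<Rightarrow> 'n phase \<Rightarrow> real poly"
  assumes n: "n = CARD('n)" and n_ge_2: "n \<ge> 2" and N: "N = 2 * n + 1"
    and mn: "bij_betw mn UNIV {(j, k). j < k}"
    \<comment> \<open>the function \<open>F\<close>\<close>
    and U0: "U0 \<in> U_set n"
    and c_d: "\<And>i j. i \<in> {1..N} \<Longrightarrow> j \<in> {1..N} \<Longrightarrow> i \<noteq> j \<Longrightarrow>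
        c j - c i > snd (eta U0 i) \<bullet> (fst (eta U0 j) - fst (eta U0 i))
                    + d i \<bullet> minors mn (fst (eta U0 j) - fst (eta U0 i))"
    and eps: "\<epsilon> > 0"
    and G_smooth: "smooth_on UNIV G" and G_convex: "convex_on UNIV G"
    and G_val: "\<And>i. i \<in> {1..N} \<Longrightarrow> G (fst (eta U0 i), minors mn (fst (eta U0 i))) = c i"
    and G_grad: "\<And>i. i \<in> {1..N} \<Longrightarrow>
        GDERIV G (fst (eta U0 i), minors mn (fst (eta U0 i))) :>
          (snd (eta U0 i) - \<epsilon> *\<^sub>R fst (eta U0 i) - v_DJ mn (d i) (fst (eta U0 i)), d i)"
    and F0: "\<And>A. F0 A = \<epsilon> / 2 * (norm A)\<^sup>2 + G (A, minors mn A)"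
    and zeta_smooth: "smooth_on UNIV \<zeta>"
    and zeta_supp: "closure {A. \<zeta> A \<noteq> 0} \<subseteq> ball 0 1"
    and zeta_range: "\<And>A. 0 \<le> \<zeta> A \<and> \<zeta> A \<le> 1"
    and zeta_0: "\<zeta> 0 = 1"
    and V_0: "\<And>H t. sym_tensor H \<Longrightarrow> t > 0 \<Longrightarrow>
        V_fun \<zeta> H t 0 = 0 \<and> gradient (V_fun \<zeta> H t) 0 = 0 \<and> hessian (V_fun \<zeta> H t) 0 = H"
    and V_bound: "\<And>H t A. sym_tensor H \<Longrightarrow> t > 0 \<Longrightarrow>
        norm (hessian (V_fun \<zeta> H t) A) \<le> C0 * norm H"
    and r0: "r0 = Min {norm (fst (eta U0 i) - fst (eta U0 j) :: 'n mat2) | i j.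
                        i \<in> {1..N} \<and> j \<in> {1..N} \<and> i \<noteq> j}"
    and r0_pos: "r0 > 0"
    and H0: "\<And>j. j \<in> {1..N} \<Longrightarrow> sym_tensor (H0 j)"
    and Ht: "\<And>j. j \<in> {1..N} \<Longrightarrow> Ht j = H0 j - hessian F0 (fst (eta U0 j))"
    and F: "\<And>A. F A = F0 A + (\<Sum>j=1..N. V_fun \<zeta> (Ht j) r0 (A - fst (eta U0 j)))"
    and dPsi: "Determinant.det (dPsi_dU F 0 U0) \<noteq> 0"
    and Ht_small: "(\<Sum>j=1..N. norm (Ht j)) < \<epsilon> / (2 * C0)"
    \<comment> \<open>the functions of \<open>\<rho>\<close>, for radii \<open>r \<le> R\<close>\<close>
    and R_pos: "R > 0"
    and U_range: "\<And>\<rho>. \<rho> \<in> cball 0 R \<Longrightarrow> U \<rho> \<in> U_set n"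
    and U_smooth: "\<exists>S. open S \<and> cball 0 R \<subseteq> S \<and>
                     (\<forall>k \<in> set (coords n). smooth_on S (\<lambda>\<rho>. U \<rho> k))"
    and U_0: "U 0 = U0"
    and U_Psi: "\<And>\<rho> i. \<rho> \<in> cball 0 R \<Longrightarrow> i \<in> {1..N} \<Longrightarrow> Psi F \<rho> (U \<rho>) i = 0"
    and pi_det: "\<And>i \<rho>. i \<in> {1..N} \<Longrightarrow> \<rho> \<in> cball 0 R \<Longrightarrow>
        Determinant.det (jacobian (pi_fun U i) \<rho>) \<noteq> 0"
    and pi_open: "\<And>i r. i \<in> {1..N} \<Longrightarrow> 0 < r \<Longrightarrow> r \<le> R \<Longrightarrow> open (pi_fun U i ` ball 0 r)"
    and xi_disjoint: "disjoint_family_on (\<lambda>i. (fst \<circ> xi_fun U i) ` cball 0 R) {1..N}"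
    and pi_disjoint: "disjoint_family_on (\<lambda>i. (fst \<circ> pi_fun U i) ` cball 0 R) {1..N}"
    and Q_char_poly: "\<And>i \<rho>. i \<in> {1..N} \<Longrightarrow> \<rho> \<in> cball 0 R \<Longrightarrow>
        char_poly (M_mat U i \<rho>) = [:0, 1:] ^ (n + 1) * [:1, 1:] ^ (2 * n) * Q i \<rho>"
    and Q_monic: "\<And>i \<rho>. i \<in> {1..N} \<Longrightarrow> \<rho> \<in> cball 0 R \<Longrightarrow>
        lead_coeff (Q i \<rho>) = 1 \<and> degree (Q i \<rho>) = n - 1"
    \<comment> \<open>nondegeneracy at \<open>0\<close>\<close>
    and Q_discriminant: "\<And>i. i \<in> {1..N} \<Longrightarrow> discriminant (Q i 0) \<noteq> 0"
    and Q_minus_1: "\<And>i. i \<in> {1..N} \<Longrightarrow> poly (Q i 0) (-1) \<noteq> 0"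
    and Q_adj: "\<And>i x. i \<in> {1..N} \<Longrightarrow> x \<in> E_set (Q i 0) \<Longrightarrow>
        (adj_mat (x \<cdot>\<^sub>m 1\<^sub>m (4 * n) - M_mat U i 0) * adj_mat (jacobian (pi_fun U i) 0))
          *\<^sub>v phase_vec (z_fun U i 0) \<noteq> 0\<^sub>v (4 * n)"
  shows "\<forall>\<^sub>F r in at_right 0. \<exists>\<delta>\<in>{0<..<1}. \<forall>l. \<delta> \<le> l \<and> l < 1 \<longrightarrow>
           (\<forall>i\<in>{1..N}. open (S_set U r l i)) \<and> disjoint_family_on (S_set U r l) {1..N}"
proof -

  \<comment> \<open>Derivatives of \<open>pi_fun\<close> and \<open>z_fun\<close> and the
    determinant of their pencil\<close>
  let ?B = "ball 0 R :: 'n phase set"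
  have card: "CARD('n) \<ge> 2" using n n_ge_2 by simp
  have U': "\<And>\<rho>. \<rho> \<in> ?B \<Longrightarrow> U \<rho> \<in> U_set CARD('n)"
    using U_range n by simp
  have C1_U: "C1_on ?B (\<lambda>\<rho>. U \<rho> k)" if "k \<in> set (coords CARD('n))" for k
    using U_smooth that n by (meson C1_on_subset ball_subset_cball smooth_on_imp_C1_on)
  have N': "N = 2 * CARD('n) + 1" using N n by simp
  have pi: "C1_on ?B (pi_fun U i)" and z: "C1_on ?B (z_fun U i)" if "i \<in> {1..N}" for i
    using C1_on_pi_fun[OF card open_ball U' C1_U] C1_on_z_fun[OF card open_ball U' C1_U] that N' by simp_all
  define A where "A i \<rho> = frechet_derivative (pi_fun U i) (at \<rho>)" for i and \<rho> :: "'n phase"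
  define Z where "Z i \<rho> = frechet_derivative (z_fun U i) (at \<rho>)" for i and \<rho> :: "'n phase"
  have A: "(pi_fun U i has_derivative A i \<rho>) (at \<rho>)" and Z: "(z_fun U i has_derivative Z i \<rho>) (at \<rho>)"
    if "i \<in> {1..N}" "\<rho> \<in> ?B" for i \<rho>
    using C1_on_frechet_derivative(1)[OF pi] C1_on_frechet_derivative(1)[OF z] that
    by (simp_all add: A_def Z_def)
  have det_A: "Determinant.det (phase_mat (A i \<rho>)) \<noteq> 0" if "i \<in> {1..N}" "\<rho> \<in> ?B" for i \<rho>
    using pi_det[of i \<rho>] that by (simp add: A_def jacobian_def)
  \<comment> \<open>The left-hand side contains no inverse, so it is continuous in
    \<open>\<rho>\<close> and carries regularity over to \<open>Q\<close>.\<close>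
  have pencil: "Determinant.det (phase_mat (\<lambda>v. x *\<^sub>R A i \<rho> v - Z i \<rho> v)) =
      Determinant.det (phase_mat (A i \<rho>)) * (x ^ (n + 1) * (x + 1) ^ (2 * n) * poly (Q i \<rho>) x)"
    if "i \<in> {1..N}" "\<rho> \<in> ?B" for i \<rho> x
  proof -
    have "char_poly (phase_mat (inv_into UNIV (A i \<rho>) \<circ> Z i \<rho>)) =
        [:0, 1:] ^ (n + 1) * [:1, 1:] ^ (2 * n) * Q i \<rho>"
      using Q_char_poly[of i \<rho>] that by (simp add: M_mat_def A_def Z_def)
    then show ?thesis
      using det_phase_mat_pencil[OF has_derivative_linear[OF A[OF that]] det_A[OF that], of x "Z i \<rho>"]
      by (simp add: poly_power add.commute)
  qed

  \<comment> \<open>Nonvanishing of \<open>Q\<close> near \<open>\<rho> = 0\<close> and argument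
    -1\<close>
  have cont_Q: "continuous_on ?B (\<lambda>\<rho>. poly (Q i \<rho>) t)" if i: "i \<in> {1..N}" and t: "t > 0" for i t
  proof -
    \<comment> \<open>For \<open>t > 0\<close> the factors \<open>t\<close> and \<open>t + 1\<close>
      are nonzero, so \<open>Q\<close> is a quotient of continuous determinants.\<close>
    have "poly (Q i \<rho>) t = Determinant.det (phase_mat (\<lambda>v. t *\<^sub>R A i \<rho> v - Z i \<rho> v)) /
        (Determinant.det (phase_mat (A i \<rho>)) * (t ^ (n + 1) * (t + 1) ^ (2 * n)))" if "\<rho> \<in> ?B" for \<rho>
      using pencil[OF i that, of t] det_A[OF i that] t by (simp add: field_simps)
    moreover have "continuous_on ?B (\<lambda>\<rho>. Determinant.det (phase_mat (\<lambda>v. t *\<^sub>R A i \<rho> v - Z i \<rho> v)) /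
        (Determinant.det (phase_mat (A i \<rho>)) * (t ^ (n + 1) * (t + 1) ^ (2 * n))))"
      unfolding A_def Z_def
      by (intro continuous_intros continuous_on_det_phase_mat C1_on_frechet_derivative(2) pi z i)
        (use det_A[OF i] t in \<open>auto simp: A_def\<close>)
    ultimately show ?thesis by - (rule continuous_on_eq, assumption, simp)
  qed
  have "\<forall>\<^sub>F p in nhds 0 \<times>\<^sub>F nhds (-1). \<forall>i\<in>{1..N}. poly (Q i (fst p)) (snd p) \<noteq> 0"
  proof (rule eventually_ball_finite, simp, intro ballI)
    fix i assume i: "i \<in> {1..N}"
    have "\<forall>\<^sub>F (\<rho>, x) in nhds 0 \<times>\<^sub>F nhds (-1). poly (Q i \<rho>) x \<noteq> 0"
      by (rule eventually_poly_nonzero[where S = ?B and n = n])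
        (use cont_Q[OF i] Q_monic[OF i] Q_minus_1[OF i] R_pos n_ge_2 in auto)
    then show "\<forall>\<^sub>F p in nhds 0 \<times>\<^sub>F nhds (-1). poly (Q i (fst p)) (snd p) \<noteq> 0"
      by (simp add: case_prod_unfold)
  qed
  \<comment> \<open>The product filter separates the conditions: \<open>P1\<close> restricts the
    radius and \<open>P2\<close> restricts \<open>l\<close>, both uniformly in
    \<open>i\<close>.\<close>
  then obtain P1 P2 where P: "eventually P1 (nhds 0)" "eventually P2 (nhds (-1))"
    "\<And>\<rho> x i. P1 \<rho> \<Longrightarrow> P2 x \<Longrightarrow> i \<in> {1..N} \<Longrightarrow> poly (Q i \<rho>) x \<noteq> 0"
    unfolding eventually_prod_filter by auto
  obtain r1 where r1: "r1 > 0" "\<And>\<rho>. \<rho> \<in> ball 0 r1 \<Longrightarrow> P1 \<rho>"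
    using P(1) unfolding eventually_nhds_metric by (auto simp: dist_commute)

  \<comment> \<open>Disjointness for \<open>l\<close> near 1\<close>
  have S_eq: "S_set U r l i = (\<lambda>\<rho>. xi_fun U i \<rho> - (1 - l) *\<^sub>R z_fun U i \<rho>) ` ball 0 r" for r l i
    by (simp add: S_set_def xi_fun_eq algebra_simps)
  \<comment> \<open>This form has derivative \<open>A + l Z\<close> and serves openness; the
    previous one, a perturbation of \<open>xi_fun\<close>, serves disjointness.\<close>
  have S_eq': "S_set U r l i = (\<lambda>\<rho>. pi_fun U i \<rho> + l *\<^sub>R z_fun U i \<rho>) ` ball 0 r" for r l i
    by (simp add: S_set_def xi_fun_eq algebra_simps)
  \<comment> \<open>Half the radius gives a compact set inside the open ball on which the functions
    are \<open>C1_on\<close>.\<close>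
  define K where "K = (cball 0 (R / 2) :: 'n phase set)"
  have K: "compact K" "K \<subseteq> ?B" "K \<subseteq> cball 0 R"
    using R_pos by (auto simp: K_def)
  have cont_K: "continuous_on K (xi_fun U i)" "continuous_on K (z_fun U i)" if "i \<in> {1..N}" for i
  proof -
    have "continuous_on K (pi_fun U i)" "continuous_on K (z_fun U i)"
      using C1_on_continuous_on[OF pi[OF that]] C1_on_continuous_on[OF z[OF that]] K(2)
      by (auto intro: continuous_on_subset)
    then show "continuous_on K (xi_fun U i)" "continuous_on K (z_fun U i)"
      by (simp_all add: xi_fun_eq[abs_def] continuous_on_add)
  qed
  have "\<forall>\<^sub>F l in at_left 1. \<forall>ij\<in>{(i, j) \<in> {1..N} \<times> {1..N}. i \<noteq> j}.
      (\<lambda>\<rho>. xi_fun U (fst ij) \<rho> - (1 - l) *\<^sub>R z_fun U (fst ij) \<rho>) ` K \<inter>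
      (\<lambda>\<rho>. xi_fun U (snd ij) \<rho> - (1 - l) *\<^sub>R z_fun U (snd ij) \<rho>) ` K = {}"
  proof (rule eventually_ball_finite)
    show "finite {(i, j) \<in> {1..N} \<times> {1..N}. i \<noteq> j}"
      by (rule finite_subset[of _ "{1..N} \<times> {1..N}"]) auto
    show "\<forall>ij\<in>{(i, j) \<in> {1..N} \<times> {1..N}. i \<noteq> j}. \<forall>\<^sub>F l in at_left 1.
      (\<lambda>\<rho>. xi_fun U (fst ij) \<rho> - (1 - l) *\<^sub>R z_fun U (fst ij) \<rho>) ` K \<inter>
      (\<lambda>\<rho>. xi_fun U (snd ij) \<rho> - (1 - l) *\<^sub>R z_fun U (snd ij) \<rho>) ` K = {}"
    proof (intro ballI eventually_disjoint_images K(1) cont_K)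
      fix ij assume ij: "ij \<in> {(i, j) \<in> {1..N} \<times> {1..N}. i \<noteq> j}"
      then have "(fst \<circ> xi_fun U (fst ij)) ` cball 0 R \<inter> (fst \<circ> xi_fun U (snd ij)) ` cball 0 R = {}"
        using xi_disjoint unfolding disjoint_family_on_def by (simp add: case_prod_unfold)
      then show "(fst \<circ> xi_fun U (fst ij)) ` K \<inter> (fst \<circ> xi_fun U (snd ij)) ` K = {}"
        using K(3) by blast
    qed (auto simp: case_prod_unfold)
  qed
  \<comment> \<open>The critical argument \<open>-1/l\<close> tends to -1 as \<open>l\<close> tends
    to 1 from below.\<close>
  moreover have "\<forall>\<^sub>F l in at_left 1. P2 (- 1 / l)"
  proof -
    have "((\<lambda>l::real. - 1 / l) \<longlongrightarrow> - 1 / 1) (at_left 1)"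
      by (intro tendsto_intros) simp
    then show ?thesis using P(2) eventually_compose_filterlim[of P2 "nhds (-1)"] by simp
  qed
  ultimately have "\<forall>\<^sub>F l in at_left 1. P2 (- 1 / l) \<and> (\<forall>ij\<in>{(i, j) \<in> {1..N} \<times> {1..N}. i \<noteq> j}.
      (\<lambda>\<rho>. xi_fun U (fst ij) \<rho> - (1 - l) *\<^sub>R z_fun U (fst ij) \<rho>) ` K \<inter>
      (\<lambda>\<rho>. xi_fun U (snd ij) \<rho> - (1 - l) *\<^sub>R z_fun U (snd ij) \<rho>) ` K = {})"
    by eventually_elim blast
  then obtain b where b: "b < 1" "\<And>l. b < l \<Longrightarrow> l < 1 \<Longrightarrow> P2 (- 1 / l)"
    "\<And>l i j. b < l \<Longrightarrow> l < 1 \<Longrightarrow> i \<in> {1..N} \<Longrightarrow> j \<in> {1..N} \<Longrightarrow> i \<noteq> j \<Longrightarrow>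
      (\<lambda>\<rho>. xi_fun U i \<rho> - (1 - l) *\<^sub>R z_fun U i \<rho>) ` K \<inter>
      (\<lambda>\<rho>. xi_fun U j \<rho> - (1 - l) *\<^sub>R z_fun U j \<rho>) ` K = {}"
    unfolding eventually_at_left_field by fastforce
  \<comment> \<open>The midpoint lies strictly above \<open>b\<close>, so
    \<open>l = \<delta>\<close> itself is admissible; the bound \<open>1/2\<close> keeps
    \<open>\<delta>\<close> positive.\<close>
  define \<delta> where "\<delta> = max (1 / 2) ((b + 1) / 2)"
  have \<delta>: "\<delta> \<in> {0<..<1}" "b < \<delta>" using b(1) by (auto simp: \<delta>_def less_max_iff_disj)

  \<comment> \<open>Openness and disjointness for fixed \<open>r\<close> and
    \<open>l\<close>\<close>
  have main: "(\<forall>i\<in>{1..N}. open (S_set U r l i)) \<and> disjoint_family_on (S_set U r l) {1..N}"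
    if r: "0 < r" "r < min r1 (R / 2)" and l: "\<delta> \<le> l" "l < 1" for r l
  proof (intro conjI ballI)
    have l': "b < l" "0 < l" using l \<delta> by auto
    show "open (S_set U r l i)" if i: "i \<in> {1..N}" for i
      unfolding S_eq'
    proof (rule open_image_if_surj_derivative)
      fix \<rho> :: "'n phase" assume \<rho>: "\<rho> \<in> ball 0 r"
      then have \<rho>': "\<rho> \<in> ?B" "P1 \<rho>" using r R_pos r1(2) by auto
      show "((\<lambda>\<rho>. pi_fun U i \<rho> + l *\<^sub>R z_fun U i \<rho>) has_derivative (\<lambda>v. A i \<rho> v + l *\<^sub>R Z i \<rho> v)) (at \<rho>)"
        by (intro derivative_intros A Z i \<rho>')
      \<comment> \<open>Since \<open>x l = -1\<close>, \<open>x (A + l Z) = x A - Z\<close>. Here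
        \<open>l < 1\<close> gives \<open>x \<noteq> -1\<close>, so only the factor \<open>Q\<close>
        could make the pencil singular.\<close>
      define x where "x = - 1 / l"
      have "x \<noteq> 0" "x + 1 \<noteq> 0" using l l' by (auto simp: x_def field_simps)
      moreover have "poly (Q i \<rho>) x \<noteq> 0"
        unfolding x_def by (rule P(3)[OF \<rho>'(2) b(2)[OF l'(1) l(2)] i])
      ultimately have "Determinant.det (phase_mat (\<lambda>v. x *\<^sub>R A i \<rho> v - Z i \<rho> v)) \<noteq> 0"
        using pencil[OF i \<rho>'(1), of x] det_A[OF i \<rho>'(1)] by simp
      moreover have "linear (\<lambda>v. x *\<^sub>R A i \<rho> v - Z i \<rho> v)"
        using has_derivative_linear[OF A[OF i \<rho>'(1)]] has_derivative_linear[OF Z[OF i \<rho>'(1)]]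
        by (intro linear_compose_sub linear_compose_scale_right)
      ultimately have surj: "surj (\<lambda>v. x *\<^sub>R A i \<rho> v - Z i \<rho> v)"
        using bij_if_det_phase_mat bij_is_surj by blast
      show "surj (\<lambda>v. A i \<rho> v + l *\<^sub>R Z i \<rho> v)"
      \<comment> \<open>A preimage of \<open>w\<close> under \<open>A + l Z\<close> is a preimage of
        \<open>x w\<close> under \<open>x A - Z\<close>.\<close>
      proof (rule surjI)
        fix w
        have "x *\<^sub>R A i \<rho> v - Z i \<rho> v = x *\<^sub>R w" if "v = inv_into UNIV (\<lambda>v. x *\<^sub>R A i \<rho> v - Z i \<rho> v) (x *\<^sub>R w)" for v
          unfolding that by (rule surj_f_inv_f[OF surj])
        then have "x *\<^sub>R (A i \<rho> v + l *\<^sub>R Z i \<rho> v) = x *\<^sub>R w"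
          if "v = inv_into UNIV (\<lambda>v. x *\<^sub>R A i \<rho> v - Z i \<rho> v) (x *\<^sub>R w)" for v
          using that l' by (simp add: x_def algebra_simps)
        then show "A i \<rho> (inv_into UNIV (\<lambda>v. x *\<^sub>R A i \<rho> v - Z i \<rho> v) (x *\<^sub>R w)) +
            l *\<^sub>R Z i \<rho> (inv_into UNIV (\<lambda>v. x *\<^sub>R A i \<rho> v - Z i \<rho> v) (x *\<^sub>R w)) = w"
          using \<open>x \<noteq> 0\<close> by (simp only: scaleR_cancel_left) simp
      qed
    qed simp
    show "disjoint_family_on (S_set U r l) {1..N}"
      unfolding disjoint_family_on_def
    proof (intro ballI impI)
      fix i j assume ij: "i \<in> {1..N}" "j \<in> {1..N}" "i \<noteq> j"
      have "ball 0 r \<subseteq> K" using r by (auto simp: K_def)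
      then show "S_set U r l i \<inter> S_set U r l j = {}"
        unfolding S_eq using b(3)[OF l'(1) l(2) ij] by blast
    qed
  qed
  \<comment> \<open>\<open>\<delta>\<close> was fixed before \<open>r\<close>, so one value serves
    every radius below \<open>min r1 (R / 2)\<close>.\<close>
  show ?thesis
    unfolding eventually_at_right_field
    by (rule exI[of _ "min r1 (R / 2)"]) (use r1 R_pos \<delta>(1) main in \<open>auto intro!: bexI[of _ \<delta>]\<close>)
qed

end
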